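(* For every log-concave probability measure $\mu$ on $\mathbb{R}^n$, $$\sup\left\{e^{\frac{1}{8}\frac{s}{n}}\big(1-\mu(T_s(\mu))\big): s>0\right\}\le c_n,$$ where $c_n=\exp\left(\frac{n\ln n}{8}\right)$ is a constant depending only on $n$.
   Context: A Borel probability measure $\mu$ on $\mathbb{R}^n$ is called log-concave if $\mu(H)<1$ for every hyperplane $H$ of $\mathbb{R}^n$ and $\mu(\lambda A+(1-\lambda)B)\ge \mu(A)^{\lambda}\mu(B)^{1-\lambda}$ for all compact sets $A,B\subset\mathbb{R}^n$ and all $\lambda\in(0,1)$. Tukey's half-space depth of $\mu$ is $\varphi_\mu(x)=\inf\{\mu(H): H \text{ is a closed half-space of }\mathbb{R}^n\text{ containing }x\}$. For $s>0$, the floating body is $T_s(\mu)=\{x\in\mathbb{R}^n:\varphi_\mu(x)\ge e^{-s}\}$.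
   Formalization: The theorem is stated for dimension n ≥ 2, because for n = 1 the constant is c_1 = 1 and the inequality fails (e.g. uniform measure on [0,1]: T_s is empty for 0 < s < ln 2, giving e^{s/8} > 1). *)

theory Defs
  imports "HOL-Probability.Probability"
begin

definition hyperplane :: "('a::euclidean_space) set \<Rightarrow> bool" where
  "hyperplane H \<longleftrightarrow> (\<exists>a b. a \<noteq> 0 \<and> H = {x. a \<bullet> x = b})"

definition closed_halfspace :: "('a::euclidean_space) set \<Rightarrow> bool" where
  "closed_halfspace H \<longleftrightarrow> (\<exists>a b. a \<noteq> 0 \<and> H = {x. a \<bullet> x \<le> b})"

text \<open>Since \<open>0 powr t = 0\<close>, the power below is the usual one also for null sets,
  as the exponents are positive.\<close>

definition log_concave_prob :: "('a::euclidean_space) measure \<Rightarrow> bool" where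
  "log_concave_prob M \<longleftrightarrow>
     prob_space M \<and> sets M = sets borel \<and>
     (\<forall>H. hyperplane H \<longrightarrow> measure M H < 1) \<and>
     (\<forall>A B t. compact A \<longrightarrow> compact B \<longrightarrow> 0 < t \<longrightarrow> t < 1 \<longrightarrow>
        measure M {t *\<^sub>R a + (1 - t) *\<^sub>R b | a b. a \<in> A \<and> b \<in> B}
          \<ge> measure M A powr t * measure M B powr (1 - t))"

definition halfspace_depth :: "('a::euclidean_space) measure \<Rightarrow> 'a \<Rightarrow> real" where
  "halfspace_depth M x = Inf {measure M H | H. closed_halfspace H \<and> x \<in> H}"

definition floating_body :: "('a::euclidean_space) measure \<Rightarrow> real \<Rightarrow> 'a set" where
  "floating_body M s = {x. halfspace_depth M x \<ge> exp (- s)}"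

end

theory Submission
  imports Defs
begin

text \<open>Only \<open>s > n\<^sup>2 ln n\<close> matters. Suppose first that \<open>M\<close> has a log-concave density
  \<open>f \<le> B\<close>, let \<open>A\<close> be a bounded part of \<open>{f \<ge> e\<^sup>-\<^sup>t B}\<close> carrying mass \<open>a\<close>, let \<open>y\<close> be the
  centroid of \<open>M\<close> restricted to \<open>A\<close>, and contract \<open>A\<close> towards \<open>y\<close>: \<open>S = (1 - d) A + d y\<close>. If a
  half-space \<open>H\<close> contains \<open>(1 - d) z + d y\<close> with \<open>z \<in> A\<close>, then it contains \<open>(1 - d) z + d H'\<close>, where
  \<open>H'\<close> is the parallel half-space through \<open>y\<close>; log-concavity of \<open>f\<close> turns this into
  \<open>M H \<ge> d\<^sup>n e\<^sup>-\<^sup>(\<^sup>1\<^sup>-\<^sup>d\<^sup>)\<^sup>t M H'\<close>. Two applications of Jensen's inequality at the centroid finish the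
  estimate: \<open>M H' \<ge> e\<^sup>-\<^sup>1\<^sup>/\<^sup>a\<close>, because \<open>c \<mapsto> ln M {u \<bullet> w \<le> c}\<close> is concave and has mean at least \<open>-1\<close>
  under \<open>M\<close>; and \<open>M S \<ge> (1 - d)\<^sup>n a\<close>, because \<open>ln f y\<close> is at least the mean of \<open>ln f\<close> over \<open>A\<close>.
  It remains to optimise \<open>d\<close> and \<open>t\<close>.

  A general \<open>M\<close> is convolved with the uniform distribution on a small cube, which gives it a
  log-concave density without appealing to Borell's theorem; its half-space masses stay
  log-concave by a one-dimensional Prekopa-Leindler inequality.\<close>

section \<open>Log-concave functions\<close>

definition log_concave_fun :: "('a::real_vector \<Rightarrow> real) \<Rightarrow> bool" where
  "log_concave_fun f \<longleftrightarrow> (\<forall>x. 0 \<le> f x) \<and>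
     (\<forall>x y t. 0 < t \<longrightarrow> t < 1 \<longrightarrow> f x powr t * f y powr (1 - t) \<le> f (t *\<^sub>R x + (1 - t) *\<^sub>R y))"

text \<open>Zeros of \<open>f\<close> are harmless because \<open>0 powr t = 0\<close>, so only
  positive values need checking; the positivity later makes \<open>powr\<close> continuous in
  limits.\<close>

lemma log_concave_funI:
  assumes "\<And>x. 0 \<le> f x"
    and "\<And>x y t. 0 < t \<Longrightarrow> t < 1 \<Longrightarrow> 0 < f x \<Longrightarrow> 0 < f y \<Longrightarrow>
      f x powr t * f y powr (1 - t) \<le> f (t *\<^sub>R x + (1 - t) *\<^sub>R y)"
  shows "log_concave_fun f"
  unfolding log_concave_fun_def
proof (intro conjI allI impI)
  fix x y and t :: real assume t: "0 < t" "t < 1"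
  show "f x powr t * f y powr (1 - t) \<le> f (t *\<^sub>R x + (1 - t) *\<^sub>R y)"
  proof (cases "0 < f x \<and> 0 < f y")
    case False
    then have "f x = 0 \<or> f y = 0" using assms(1) by (metis less_eq_real_def)
    then show ?thesis using assms(1) t by auto
  qed (use assms t in auto)
qed (use assms in auto)

lemma log_concave_fun_nonneg: "log_concave_fun f \<Longrightarrow> 0 \<le> f x"
  by (simp add: log_concave_fun_def)

lemma log_concave_funD:
  "log_concave_fun f \<Longrightarrow> 0 < t \<Longrightarrow> t < 1 \<Longrightarrow>
    f x powr t * f y powr (1 - t) \<le> f (t *\<^sub>R x + (1 - t) *\<^sub>R y)"
  by (simp add: log_concave_fun_def)

section \<open>Jensen's inequality for log-concave functions\<close>

lemma (in prob_space) expectation_in_closed_convex: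
  fixes V :: "'a \<Rightarrow> 'b::euclidean_space"
  assumes V: "integrable M V" and ae: "AE x in M. V x \<in> C" and "closed C" "convex C"
  shows "expectation V \<in> C"
proof (rule ccontr)
  assume "expectation V \<notin> C"
  \<comment> \<open>A functional separating the mean from \<open>C\<close> exceeds \<open>b\<close>
    almost surely, so its mean cannot lie below \<open>b\<close>.\<close>
  then obtain a b where ab: "a \<bullet> expectation V < b" "\<And>x. x \<in> C \<Longrightarrow> a \<bullet> x > b"
    using separating_hyperplane_closed_point[OF \<open>convex C\<close> \<open>closed C\<close>] by blast
  have "b \<le> expectation (\<lambda>x. a \<bullet> V x)"
  proof (rule integral_ge_const)
    show "AE x in M. b \<le> a \<bullet> V x" using ae by eventually_elim (use ab(2) in force)
  qed (use V in simp)
  then show False using ab(1) V by simp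
qed

lemma convex_hypograph_log_concave:
  assumes lc: "log_concave_fun f"
  shows "convex {(y, r). exp r \<le> f y}"
proof (rule convexI, clarsimp)
  fix y1 y2 :: 'a and r1 r2 u v :: real
  assume h: "exp r1 \<le> f y1" "exp r2 \<le> f y2" "0 \<le> u" "0 \<le> v" "u + v = 1"
  consider "u = 0" | "u = 1" | "0 < u" "u < 1" using h by linarith
  then show "exp (u * r1 + v * r2) \<le> f (u *\<^sub>R y1 + v *\<^sub>R y2)"
  proof cases
    case 3
    have v: "v = 1 - u" using h by simp
    have "exp (u * r1 + v * r2) = exp r1 powr u * exp r2 powr v"
      by (simp add: powr_def exp_add)
    also have "\<dots> \<le> f y1 powr u * f y2 powr v"
      using h by (intro mult_mono powr_mono2) auto
    also have "\<dots> \<le> f (u *\<^sub>R y1 + v *\<^sub>R y2)"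
      using log_concave_funD[OF lc, of u y1 y2] 3 v by simp
    finally show ?thesis .
  qed (use h in auto)
qed

lemma closed_hypograph_usc:
  fixes f :: "'a::metric_space \<Rightarrow> real"
  assumes usc: "\<And>c. closed {x. c \<le> f x}"
  shows "closed {(y, r). exp r \<le> f y}"
  unfolding closed_sequential_limits
proof (intro allI impI)
  fix x :: "nat \<Rightarrow> 'a \<times> real" and l
  assume h: "(\<forall>n. x n \<in> {(y, r). exp r \<le> f y}) \<and> x \<longlonglongrightarrow> l"
  have y: "(\<lambda>n. fst (x n)) \<longlonglongrightarrow> fst l" and r: "(\<lambda>n. exp (snd (x n))) \<longlonglongrightarrow> exp (snd l)"
    using h by (auto intro!: tendsto_intros)
  \<comment> \<open>A level \<open>c\<close> strictly below the limit is eventually below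
    \<open>f\<close> along the sequence, so the closed superlevel set at \<open>c\<close> contains
    the limit point.\<close>
  have "c \<le> f (fst l)" if c: "c < exp (snd l)" for c
  proof -
    have ev: "\<forall>\<^sub>F n in sequentially. fst (x n) \<in> {x. c \<le> f x}"
      using order_tendstoD(1)[OF r c]
    proof eventually_elim
      case (elim n)
      then show ?case using h[THEN conjunct1, rule_format, of n] by (auto simp: split_beta)
    qed
    show ?thesis
      using Lim_in_closed_set[OF usc ev _ y] by simp
  qed
  then have "exp (snd l) \<le> f (fst l)" by (rule dense_le)
  then show "l \<in> {(y, r). exp r \<le> f y}" by (simp add: split_beta)
qed

text \<open>The random point \<open>(Z, ln (f Z))\<close> lies almost surely in the hypograph of
  \<open>ln f\<close>, which is closed and convex, so its mean lies there too. Writing the hypograph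
  as \<open>exp r \<le> f y\<close> handles zeros of \<open>f\<close>, where \<open>ln f\<close>
  should be minus infinity.\<close>

lemma (in prob_space) log_concave_jensen:
  fixes Z :: "'a \<Rightarrow> 'b::euclidean_space"
  assumes lc: "log_concave_fun f" and usc: "\<And>c. closed {x. c \<le> f x}"
    and Z: "integrable M Z" and I: "integrable M (\<lambda>x. ln (f (Z x)))"
    and pos: "AE x in M. 0 < f (Z x)"
  shows "exp (expectation (\<lambda>x. ln (f (Z x)))) \<le> f (expectation Z)"
proof -
  have "integrable M (\<lambda>x. (Z x, 0) + (0, ln (f (Z x))))"
    using Z I
    by (intro Bochner_Integration.integrable_add
        integrable_bounded_linear[where T = "\<lambda>x. (x, 0)"]
        integrable_bounded_linear[where T = "\<lambda>x. (0, x)"])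
      (auto intro!: bounded_linear_Pair bounded_linear_ident bounded_linear_zero)
  then have V: "integrable M (\<lambda>x. (Z x, ln (f (Z x))))" by simp
  have "expectation (\<lambda>x. (Z x, ln (f (Z x)))) \<in> {(y, r). exp r \<le> f y}"
    by (rule expectation_in_closed_convex[OF V])
      (use assms in \<open>auto intro!: convex_hypograph_log_concave closed_hypograph_usc\<close>)
  moreover have "expectation (\<lambda>x. (Z x, ln (f (Z x)))) = (expectation Z, expectation (\<lambda>x. ln (f (Z x))))"
    using integral_bounded_linear[OF bounded_linear_fst V]
      integral_bounded_linear[OF bounded_linear_snd V]
    by (simp add: prod_eq_iff)
  ultimately show ?thesis by simp
qed

lemma nn_integral_lborel_affine:
  fixes t :: "'a::euclidean_space"
  assumes [measurable]: "f \<in> borel_measurable borel" and c: "c \<noteq> 0"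
  shows "(\<integral>\<^sup>+x. f x \<partial>lborel) = ennreal (\<bar>c\<bar> ^ DIM('a)) * (\<integral>\<^sup>+x. f (t + c *\<^sub>R x) \<partial>lborel)"
  by (subst lborel_affine[OF c, of t])
    (simp add: nn_integral_density nn_integral_distr nn_integral_cmult)

lemma borel_measurable_usc:
  fixes f :: "'a::topological_space \<Rightarrow> real"
  assumes "\<And>c. closed {x. c \<le> f x}"
  shows "f \<in> borel_measurable borel"
  by (rule borel_measurableI_ge) (use assms in simp)

section \<open>Measures with log-concave density\<close>

text \<open>By Prekopa's theorem the last assumption follows from the first one; for the smoothed measures
  below it is available directly.\<close>

locale log_concave_density =
  fixes f :: "'a::euclidean_space \<Rightarrow> real"
  assumes lc: "log_concave_fun f"
    and usc: "\<And>c. closed {x. c \<le> f x}"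
    and prob: "prob_space (density lborel (\<lambda>x. ennreal (f x)))"
    and halfspace_lc: "\<And>u. log_concave_fun (\<lambda>c. measure (density lborel (\<lambda>x. ennreal (f x))) {y. u \<bullet> y \<le> c})"
begin

abbreviation N :: "'a measure" where "N \<equiv> density lborel (\<lambda>x. ennreal (f x))"

sublocale prob_space N by (rule prob)

lemma f_nonneg [simp]: "0 \<le> f x" using lc by (rule log_concave_fun_nonneg)

lemma f_measurable [measurable]: "f \<in> borel_measurable borel"
  using usc by (rule borel_measurable_usc)

lemma emeasure_N: "A \<in> sets borel \<Longrightarrow> emeasure N A = (\<integral>\<^sup>+x. ennreal (f x) * indicator A x \<partial>lborel)"
  by (simp add: emeasure_density)

lemma nn_integral_f: "(\<integral>\<^sup>+x. ennreal (f x) \<partial>lborel) = 1"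
  using emeasure_space_1 by (simp add: emeasure_density)

text \<open>The bound \<open>B\<close> is not the supremum of \<open>f\<close> but the largest value permitted by
  \<open>(f p)\<^sup>2\<^sup>/\<^sup>3 \<integral> f\<^sup>1\<^sup>/\<^sup>3 \<le> 3\<^sup>n\<close>, which comes from integrating
  \<open>f ((x + 2 p) / 3) \<ge> (f x)\<^sup>1\<^sup>/\<^sup>3 (f p)\<^sup>2\<^sup>/\<^sup>3\<close> over \<open>x\<close>. So no point need maximise \<open>f\<close>.\<close>

lemma level_set_tail:
  obtains B where "B > 0" "\<And>x. f x \<le> B"
    "\<And>t. measure N {x. f x < exp (- t) * B} \<le> 3 ^ DIM('a) * exp (- (2 * t / 3))"
proof -
  define K where "K = (\<integral>\<^sup>+x. ennreal (f x powr (1/3)) \<partial>lborel)"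
  have bound: "K * ennreal (f p powr (2/3)) \<le> ennreal (3 ^ DIM('a))" for p
  proof -
    have "K * ennreal (f p powr (2/3)) = (\<integral>\<^sup>+x. ennreal (f x powr (1/3) * f p powr (2/3)) \<partial>lborel)"
      unfolding K_def by (subst nn_integral_multc[symmetric]) (auto simp: ennreal_mult)
    also have "\<dots> \<le> (\<integral>\<^sup>+x. ennreal (f ((2/3) *\<^sub>R p + (1/3) *\<^sub>R x)) \<partial>lborel)"
      using log_concave_funD[OF lc, of "1/3" _ p]
      by (intro nn_integral_mono ennreal_leI) (simp add: add.commute)
    finally have "ennreal ((1/3) ^ DIM('a)) * (K * ennreal (f p powr (2/3)))
        \<le> ennreal ((1/3) ^ DIM('a)) * (\<integral>\<^sup>+x. ennreal (f ((2/3) *\<^sub>R p + (1/3) *\<^sub>R x)) \<partial>lborel)"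
      by (rule mult_left_mono) simp
    also have "\<dots> = 1"
      using nn_integral_lborel_affine[of "\<lambda>x. ennreal (f x)" "1/3" "(2/3) *\<^sub>R p"] nn_integral_f
      by simp
    finally have "ennreal (3 ^ DIM('a)) * (ennreal ((1/3) ^ DIM('a)) * (K * ennreal (f p powr (2/3))))
        \<le> ennreal (3 ^ DIM('a)) * 1"
      by (rule mult_left_mono) simp
    moreover have "ennreal (3 ^ DIM('a)) * (ennreal ((1/3) ^ DIM('a)) * c) = c" for c
      by (subst mult.assoc[symmetric], subst ennreal_mult[symmetric])
        (simp_all add: power_mult_distrib[symmetric])
    ultimately show ?thesis by (simp only: mult_1_right)
  qed
  have "\<exists>p. 0 < f p"
  proof (rule ccontr)
    assume "\<not> ?thesis"
    then have "f p = 0" for p by (metis f_nonneg less_eq_real_def)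
    then show False using nn_integral_f by simp
  qed
  then obtain p where p: "0 < f p" ..
  have "K \<noteq> \<top>"
  proof
    assume "K = \<top>"
    with bound[of p] p have "\<top> \<le> ennreal (3 ^ DIM('a))"
      by (simp add: ennreal_top_mult)
    then show False by (simp add: top_unique)
  qed
  moreover have "K \<noteq> 0"
  proof
    assume "K = 0"
    then have "AE x in lborel. ennreal (f x powr (1/3)) = 0"
      unfolding K_def by (subst (asm) nn_integral_0_iff_AE) auto
    then have "AE x in lborel. ennreal (f x) = 0"
    proof eventually_elim
      case (elim x)
      then have "f x powr (1/3) \<le> 0" by (simp only: ennreal_eq_0_iff)
      then have "f x = 0" by (metis powr_gt_zero not_le)
      then show ?case by simp
    qed
    then have "(\<integral>\<^sup>+x. ennreal (f x) \<partial>lborel) = 0"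
      by (subst nn_integral_0_iff_AE) auto
    then show False using nn_integral_f by simp
  qed
  ultimately obtain k where k: "K = ennreal k" "0 < k"
    by (metis ennreal_enn2real enn2real_nonneg less_le ennreal_0 top.not_eq_extremum)
  define B where "B = (3 ^ DIM('a) / k) powr (3/2)"
  have B0: "B > 0" unfolding B_def using k by simp
  have B23: "B powr (2/3) = 3 ^ DIM('a) / k"
    unfolding B_def powr_powr using k by simp
  have B: "f x \<le> B" for x
  proof -
    have "ennreal (k * f x powr (2/3)) \<le> ennreal (3 ^ DIM('a))"
      using bound[of x] k by (simp add: ennreal_mult)
    then have "k * f x powr (2/3) \<le> 3 ^ DIM('a)" by (subst (asm) ennreal_le_iff) auto
    then have "f x powr (2/3) \<le> B powr (2/3)"
      unfolding B23 using k by (simp add: field_simps)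
    then show ?thesis using powr_less_mono2[of "2/3" B "f x"] B0 by (cases "f x \<le> B") auto
  qed
  have "measure N {x. f x < exp (- t) * B} \<le> 3 ^ DIM('a) * exp (- (2 * t / 3))" for t
  proof -
    define L where "L = {x. f x < exp (- t) * B}"
    have [measurable]: "L \<in> sets borel" unfolding L_def by simp
    have "emeasure N L \<le> (\<integral>\<^sup>+x. ennreal (exp (- (2 * t / 3)) * (3 ^ DIM('a) / k)) * ennreal (f x powr (1/3)) \<partial>lborel)"
      unfolding emeasure_N[OF \<open>L \<in> sets borel\<close>]
    proof (intro nn_integral_mono)
      fix x
      show "ennreal (f x) * indicator L x \<le> ennreal (exp (- (2 * t / 3)) * (3 ^ DIM('a) / k)) * ennreal (f x powr (1/3))"
      proof (cases "x \<in> L")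
        case True
        \<comment> \<open>On \<open>L\<close> the factor with exponent 2/3 is bounded by the level,
          the other one integrates to \<open>K\<close>, and \<open>B powr (2/3) * k = 3 ^ n\<close>
          turns the product into the claimed tail.\<close>
        have "f x = f x powr (2/3) * f x powr (1/3)"
          by (simp add: powr_add[symmetric])
        also have "\<dots> \<le> (exp (- t) * B) powr (2/3) * f x powr (1/3)"
          using True by (intro mult_right_mono powr_mono2) (auto simp: L_def)
        also have "(exp (- t) * B) powr (2/3) = exp (- (2 * t / 3)) * (3 ^ DIM('a) / k)"
          using B0 by (simp add: powr_mult exp_powr_real B23)
        finally show ?thesis using True k
          by (subst ennreal_mult[symmetric]) (auto intro!: ennreal_leI)
      qed simp
    qed
    also have "\<dots> = ennreal (exp (- (2 * t / 3)) * (3 ^ DIM('a) / k)) * K"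
      unfolding K_def by (rule nn_integral_cmult) simp
    also have "\<dots> = ennreal (3 ^ DIM('a) * exp (- (2 * t / 3)))"
      using k by (simp add: ennreal_mult[symmetric] mult.commute)
    finally show ?thesis
      unfolding L_def[symmetric] emeasure_eq_measure by (subst (asm) ennreal_le_iff) auto
  qed
  with B0 B that show thesis by blast
qed

text \<open>The map sending \<open>w\<close> to \<open>(1 - d) z + d w\<close> carries the
  half-space through \<open>y\<close> into the one bounded by \<open>b\<close> and scales volume by
  \<open>d ^ n\<close>. Along it \<open>f\<close> is at least
  \<open>f z powr (1 - d) * f w powr d\<close>, and
  \<open>f z \<ge> exp (- t) * B \<ge> exp (- t) * f w\<close> bounds this below by
  \<open>exp (- ((1 - d) * t)) * f w\<close>.\<close>

lemma depth_interpolate: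
  assumes B: "B > 0" "\<And>x. f x \<le> B" and z: "exp (- t) * B \<le> f z" and t: "0 \<le> t"
    and d: "0 < d" "d < 1"
    and H: "u \<bullet> ((1 - d) *\<^sub>R z + d *\<^sub>R y) \<le> b"
  shows "d ^ DIM('a) * exp (- ((1 - d) * t)) * measure N {w. u \<bullet> w \<le> u \<bullet> y} \<le> measure N {w. u \<bullet> w \<le> b}"
proof -
  let ?H = "{w. u \<bullet> w \<le> b}" and ?G = "{w. u \<bullet> w \<le> u \<bullet> y}"
  have [measurable]: "?H \<in> sets borel" "?G \<in> sets borel" by simp_all
  have "ennreal (exp (- ((1 - d) * t)) * measure N ?G) = (\<integral>\<^sup>+w. ennreal (exp (- ((1 - d) * t))) * (ennreal (f w) * indicator ?G w) \<partial>lborel)"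
    by (subst nn_integral_cmult) (simp_all add: emeasure_N[symmetric] emeasure_eq_measure ennreal_mult)
  also have "\<dots> \<le> (\<integral>\<^sup>+w. ennreal (f ((1 - d) *\<^sub>R z + d *\<^sub>R w)) * indicator ?H ((1 - d) *\<^sub>R z + d *\<^sub>R w) \<partial>lborel)"
  proof (intro nn_integral_mono)
    fix w
    show "ennreal (exp (- ((1 - d) * t))) * (ennreal (f w) * indicator ?G w) \<le> ennreal (f ((1 - d) *\<^sub>R z + d *\<^sub>R w)) * indicator ?H ((1 - d) *\<^sub>R z + d *\<^sub>R w)"
    proof (cases "w \<in> ?G")
      case True
      then have "d * (u \<bullet> w) \<le> d * (u \<bullet> y)" using d by simp
      with H have "(1 - d) *\<^sub>R z + d *\<^sub>R w \<in> ?H" by (simp add: inner_add_right)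
      moreover have "exp (- ((1 - d) * t)) * f w \<le> f ((1 - d) *\<^sub>R z + d *\<^sub>R w)"
      proof -
        have "exp (- ((1 - d) * t)) * f w = exp (- t) powr (1 - d) * (f w powr (1 - d) * f w powr d)"
          by (simp add: powr_add[symmetric] exp_powr_real mult.commute)
        also have "\<dots> \<le> exp (- t) powr (1 - d) * (B powr (1 - d) * f w powr d)"
          using d B by (intro mult_left_mono mult_right_mono powr_mono2) auto
        also have "\<dots> = (exp (- t) * B) powr (1 - d) * f w powr d"
          using B by (simp add: powr_mult)
        also have "\<dots> \<le> f z powr (1 - d) * f w powr d"
          using d B z by (intro mult_right_mono powr_mono2) auto
        also have "\<dots> \<le> f ((1 - d) *\<^sub>R z + d *\<^sub>R w)"
          using log_concave_funD[OF lc, of "1 - d" z w] d by simp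
        finally show ?thesis .
      qed
      ultimately show ?thesis using True
        by (simp add: ennreal_mult[symmetric] ennreal_leI)
    qed simp
  qed
  finally have "ennreal (d ^ DIM('a)) * ennreal (exp (- ((1 - d) * t)) * measure N ?G)
      \<le> ennreal (d ^ DIM('a)) * \<dots>"
    by (rule mult_left_mono) simp
  also have "\<dots> = emeasure N ?H"
    unfolding emeasure_N[OF \<open>?H \<in> sets borel\<close>]
    using nn_integral_lborel_affine[of "\<lambda>w. ennreal (f w) * indicator ?H w" d "(1 - d) *\<^sub>R z"] d by simp
  finally show ?thesis
    using d by (simp add: ennreal_mult[symmetric] emeasure_eq_measure mult.assoc)
qed

end

section \<open>The distribution function evaluated at its own random variable\<close>

lemma (in prob_space) prob_cdf_le:
  fixes X :: "'a \<Rightarrow> real"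
  assumes [measurable]: "X \<in> borel_measurable M" and p: "0 \<le> p"
  shows "prob {x \<in> space M. prob {y \<in> space M. X y \<le> X x} \<le> p} \<le> p"
proof -
  define G where "G c = prob {y \<in> space M. X y \<le> c}" for c
  have mono: "G c \<le> G c'" if "c \<le> c'" for c c'
    unfolding G_def using that by (intro finite_measure_mono) auto
  \<comment> \<open>\<open>S\<close> is closed downwards, so it is exhausted by countably many
    half-lines with endpoints in \<open>S\<close>. Each has probability at most \<open>p\<close>,
    and continuity from below passes this on to the union.\<close>
  define S where "S = {c. G c \<le> p}"
  have down: "c \<in> S" if "c' \<in> S" "c \<le> c'" for c c'
    using that mono[of c c'] by (auto simp: S_def)
  have "prob {x \<in> space M. X x \<in> S} \<le> p"
  proof (cases "S = {}")
    case False
    then obtain c1 where c1: "c1 \<in> S" by auto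
    \<comment> \<open>The endpoints are constantly \<open>Sup S\<close> if the supremum is attained,
      \<open>Sup S - 1 / (k + 1)\<close> if it is finite but not attained, and \<open>k\<close> if
      \<open>S\<close> is the whole line.\<close>
    have "\<exists>c. incseq c \<and> range c \<subseteq> S \<and> S \<subseteq> (\<Union>k::nat. {..c k})"
    proof (cases "bdd_above S")
      case bdd: True
      show ?thesis
      proof (cases "Sup S \<in> S")
        case True
        then show ?thesis using cSup_upper[OF _ bdd] by (intro exI[of _ "\<lambda>_. Sup S"]) auto
      next
        case False
        have less: "x < Sup S" if "x \<in> S" for x
          using cSup_upper[OF that bdd] that False by (cases "x = Sup S") auto
        have "Sup S - 1 / real (Suc k) \<in> S" for k
        proof -
          have "Sup S - 1 / real (Suc k) < Sup S" by simp
          then obtain x where "x \<in> S" "Sup S - 1 / real (Suc k) < x"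
            using less_cSup_iff[OF \<open>S \<noteq> {}\<close> bdd] by blast
          then show ?thesis using down by (meson less_imp_le)
        qed
        moreover have "\<exists>k. x \<le> Sup S - 1 / real (Suc k)" if x: "x \<in> S" for x
        proof -
          obtain k where "inverse (real (Suc k)) < Sup S - x"
            using reals_Archimedean[of "Sup S - x"] less[OF x] by auto
          then show ?thesis by (intro exI[of _ k]) (simp add: inverse_eq_divide)
        qed
        ultimately show ?thesis
          by (intro exI[of _ "\<lambda>k. Sup S - 1 / real (Suc k)"])
            (auto simp: incseq_def frac_le)
      qed
    next
      case False
      then have "c \<in> S" for c using down by (meson bdd_above.unfold less_imp_le not_le)
      then show ?thesis
        by (intro exI[of _ real]) (auto simp: incseq_def real_arch_simple)
    qed
    then obtain c where c: "incseq c" "\<And>k. c k \<in> S" "S \<subseteq> (\<Union>k::nat. {..c k})" by blast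
    define A where "A k = {x \<in> space M. X x \<le> c k}" for k
    have "(\<lambda>k. prob (A k)) \<longlonglongrightarrow> prob (\<Union>k. A k)"
      using c(1) by (intro finite_Lim_measure_incseq) (auto simp: A_def incseq_def intro: order_trans)
    moreover have "prob (A k) \<le> p" for k using c(2)[of k] by (simp add: S_def G_def A_def)
    ultimately have "prob (\<Union>k. A k) \<le> p" by (intro LIMSEQ_le_const2) auto
    moreover have "prob {x \<in> space M. X x \<in> S} \<le> prob (\<Union>k. A k)"
      using c(3) by (intro finite_measure_mono) (auto simp: A_def subset_iff)
    ultimately show ?thesis by simp
  qed (use p in simp)
  then show ?thesis by (simp add: S_def G_def)
qed

text \<open>Write \<open>- ln G\<close> as the integral of \<open>1 / p\<close> over
  \<open>{G..1}\<close> and exchange the integrals: the inner one becomes \<open>1 / p\<close> times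
  the probability of \<open>G (X x) \<le> p\<close>, at most 1 by \<open>prob_cdf_le\<close>. Atoms
  of \<open>X\<close> are allowed.\<close>

lemma (in prob_space) nn_integral_minus_ln_cdf:
  fixes X :: "'a \<Rightarrow> real"
  assumes [measurable]: "X \<in> borel_measurable M"
  defines "G \<equiv> \<lambda>c. prob {y \<in> space M. X y \<le> c}"
  shows "AE x in M. 0 < G (X x)" and "(\<integral>\<^sup>+x. ennreal (- ln (G (X x))) \<partial>M) \<le> 1"
proof -
  have "mono G"
    unfolding G_def mono_def by (intro allI impI finite_measure_mono) auto
  then have [measurable]: "G \<in> borel_measurable borel" by (rule borel_measurable_mono)
  have le: "prob {x \<in> space M. G (X x) \<le> p} \<le> p" if "0 \<le> p" for p
    using prob_cdf_le[of X p] that by (simp add: G_def)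
  have G0: "0 \<le> G c" "G c \<le> 1" for c by (auto simp: G_def)
  have "prob {x \<in> space M. G (X x) \<le> 0} = 0"
    using le[of 0] by (simp add: measure_le_0_iff)
  then have "AE x in M. \<not> G (X x) \<le> 0"
    by (subst (asm) prob_eq_0) auto
  then show pos: "AE x in M. 0 < G (X x)" by (simp add: not_le)
  have "(\<integral>\<^sup>+x. ennreal (- ln (G (X x))) \<partial>M) =
    (\<integral>\<^sup>+x. (\<integral>\<^sup>+p. ennreal (1 / p) * indicator {G (X x)..1} p \<partial>lborel) \<partial>M)"
  proof (rule nn_integral_cong_AE)
    show "AE x in M. ennreal (- ln (G (X x))) = (\<integral>\<^sup>+p. ennreal (1 / p) * indicator {G (X x)..1} p \<partial>lborel)"
      using pos
    proof eventually_elim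
      case (elim x)
      have "(\<integral>\<^sup>+p. ennreal (1 / p) * indicator {G (X x)..1} p \<partial>lborel) = ennreal (ln 1 - ln (G (X x)))"
        using elim G0(2) by (intro nn_integral_FTC_Icc) (auto intro!: derivative_eq_intros)
      then show ?case by simp
    qed
  qed
  also have "\<dots> = (\<integral>\<^sup>+p. (\<integral>\<^sup>+x. ennreal (1 / p) * indicator {G (X x)..1} p \<partial>M) \<partial>lborel)"
  proof -
    interpret pair_sigma_finite M lborel ..
    have "(\<lambda>(x, p). ennreal (1 / p) * indicator {z. G (X (fst z)) \<le> snd z \<and> snd z \<le> 1} (x, p)) \<in>
        borel_measurable (M \<Otimes>\<^sub>M lborel)" by measurable
    also have "?this \<longleftrightarrow> (\<lambda>(x, p). ennreal (1 / p) * indicator {G (X x)..1} p) \<in> borel_measurable (M \<Otimes>\<^sub>M lborel)"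
      by (intro arg_cong2[where f = "(\<in>)"] ext refl) (auto simp: indicator_def)
    finally show ?thesis by (rule Fubini'[symmetric])
  qed
  also have "\<dots> \<le> (\<integral>\<^sup>+p. indicator {0..1} p \<partial>(lborel :: real measure))"
  proof (rule nn_integral_mono)
    fix p :: real
    have "(\<integral>\<^sup>+x. ennreal (1 / p) * indicator {G (X x)..1} p \<partial>M) =
        (\<integral>\<^sup>+x. ennreal (1 / p) * indicator {..1} p * indicator {x \<in> space M. G (X x) \<le> p} x \<partial>M)"
      by (intro nn_integral_cong) (auto simp: indicator_def)
    also have "\<dots> = ennreal (1 / p) * indicator {..1} p * emeasure M {x \<in> space M. G (X x) \<le> p}"
      by (subst nn_integral_cmult) auto
    also have "\<dots> \<le> indicator {0..1} p"
    proof (cases "0 < p \<and> p \<le> 1")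
      case True
      then have "ennreal (1 / p) * emeasure M {x \<in> space M. G (X x) \<le> p} \<le> ennreal (1 / p) * ennreal p"
        using le[of p] by (intro mult_left_mono) (auto simp: emeasure_eq_measure intro!: ennreal_leI)
      also have "\<dots> = 1" using True by (simp add: ennreal_mult[symmetric])
      finally show ?thesis using True by simp
    next
      \<comment> \<open>For \<open>p \<le> 0\<close> the quotient \<open>1 / p\<close> is
        nonpositive, also at \<open>1 / 0 = 0\<close>, so \<open>ennreal\<close> sends it to 0; for
        \<open>p > 1\<close> the indicator vanishes.\<close>
      case False
      then have "p \<le> 0 \<or> p > 1" by auto
      then have "ennreal (1 / p) * indicator {..1} p = 0"
        by (auto simp: ennreal_neg divide_nonneg_nonpos)
      then show ?thesis by (simp only: mult_zero_left zero_le)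
    qed
    finally show "(\<integral>\<^sup>+x. ennreal (1 / p) * indicator {G (X x)..1} p \<partial>M) \<le> indicator {0..1} p" .
  qed
  also have "\<dots> = 1" by simp
  finally show "(\<integral>\<^sup>+x. ennreal (- ln (G (X x))) \<partial>M) \<le> 1" .
qed

text \<open>Distribution functions are increasing and right-continuous, hence upper semicontinuous,
  as Jensen's inequality above requires.\<close>

lemma (in prob_space) closed_superlevel_cdf:
  fixes X :: "'a \<Rightarrow> real"
  assumes [measurable]: "X \<in> borel_measurable M"
  shows "closed {c. k \<le> prob {y \<in> space M. X y \<le> c}}"
  unfolding closed_sequential_limits
proof (intro allI impI)
  fix x :: "nat \<Rightarrow> real" and l
  assume h: "(\<forall>n. x n \<in> {c. k \<le> prob {y \<in> space M. X y \<le> c}}) \<and> x \<longlonglongrightarrow> l"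
  define A where "A m = {y \<in> space M. X y \<le> l + 1 / real (Suc m)}" for m
  have "k \<le> prob (A m)" for m
  proof -
    have "\<forall>\<^sub>F n in sequentially. x n < l + 1 / real (Suc m)"
      using h by (intro order_tendstoD) auto
    then obtain n where n: "x n < l + 1 / real (Suc m)" by (auto simp: eventually_sequentially)
    have "k \<le> prob {y \<in> space M. X y \<le> x n}" using h by auto
    also have "\<dots> \<le> prob (A m)" using n by (intro finite_measure_mono) (auto simp: A_def)
    finally show ?thesis .
  qed
  moreover have "(\<lambda>m. prob (A m)) \<longlonglongrightarrow> prob (\<Inter>m. A m)"
  proof (rule finite_Lim_measure_decseq)
    show "decseq A"
      unfolding decseq_def A_def by (auto elim!: order_trans intro!: frac_le)
  qed (auto simp: A_def)
  ultimately have "k \<le> prob (\<Inter>m. A m)" by (intro LIMSEQ_le_const) auto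
  also have "(\<Inter>m. A m) = {y \<in> space M. X y \<le> l}"
  proof safe
    fix y assume y: "y \<in> (\<Inter>m. A m)"
    show "X y \<le> l"
    proof (rule field_le_epsilon)
      fix e :: real assume "0 < e"
      then obtain m where "inverse (real (Suc m)) < e" using reals_Archimedean by blast
      moreover have "X y \<le> l + 1 / real (Suc m)" using y by (auto simp: A_def)
      ultimately show "X y \<le> l + e" by (simp add: inverse_eq_divide)
    qed
  qed (auto simp: A_def add_increasing2)
  finally show "l \<in> {c. k \<le> prob {y \<in> space M. X y \<le> c}}" by simp
qed

section \<open>Depth of the centroid and mass of the contracted set\<close>

context log_concave_density
begin

text \<open>Since \<open>- ln G\<close> is nonnegative, conditioning on \<open>A\<close> raises its
  mean from at most 1 to at most \<open>1 / measure N A \<le> 1 / a\<close>. Jensen's inequality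
  then applies to \<open>G\<close>, log-concave by \<open>halfspace_lc\<close>, at the mean
  \<open>u \<bullet> y\<close> of \<open>u \<bullet> z\<close>. Boundedness of \<open>A\<close>
  makes the centroid integral converge.\<close>

lemma depth_centroid:
  assumes A: "A \<in> sets borel" "bounded A" and a: "0 < a" "a \<le> measure N A"
  defines "y \<equiv> (\<integral>z. z \<partial>uniform_measure N A)"
  shows "exp (- (1 / a)) \<le> measure N {w. u \<bullet> w \<le> u \<bullet> y}"
proof -
  define al where "al = measure N A"
  have al: "0 < al" "a \<le> al" using a by (auto simp: al_def)
  have emA: "emeasure N A = ennreal al" by (simp add: al_def emeasure_eq_measure)
  interpret V: prob_space "uniform_measure N A"
    by (rule prob_space_uniform_measure) (use al in \<open>auto simp: emA\<close>)
  obtain R where R: "\<And>z. z \<in> A \<Longrightarrow> norm z \<le> R" using A(2) by (auto simp: bounded_iff)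
  have AEA: "AE z in uniform_measure N A. z \<in> A"
    by (rule AE_uniform_measureI) (use A in auto)
  have Z: "integrable (uniform_measure N A) (\<lambda>z. z)"
    by (rule V.integrable_const_bound[of _ R]) (use AEA R in auto)
  define X where "X z = u \<bullet> z" for z
  define G where "G c = measure N {w. X w \<le> c}" for c
  have [measurable]: "X \<in> borel_measurable borel" unfolding X_def by simp
  have XN [measurable]: "X \<in> borel_measurable N" by simp
  have "mono G"
    unfolding G_def mono_def by (intro allI impI finite_measure_mono) auto
  then have [measurable]: "G \<in> borel_measurable borel" by (rule borel_measurable_mono)
  have G01: "0 \<le> G c" "G c \<le> 1" for c by (auto simp: G_def)
  note cdf = nn_integral_minus_ln_cdf[OF XN] closed_superlevel_cdf[OF XN]
  have pos: "AE z in N. 0 < G (X z)" and nn: "(\<integral>\<^sup>+z. ennreal (- ln (G (X z))) \<partial>N) \<le> 1"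
    and uscG: "closed {c. k \<le> G c}" for k
    using cdf by (simp_all add: G_def)
  have posV: "AE z in uniform_measure N A. 0 < G (X z)"
    by (subst AE_uniform_measure) (use A pos al in \<open>auto simp: emA\<close>)
  have nnV: "(\<integral>\<^sup>+z. ennreal (- ln (G (X z))) \<partial>uniform_measure N A) \<le> ennreal (1 / a)"
  proof -
    have "(\<integral>\<^sup>+z. ennreal (- ln (G (X z))) \<partial>uniform_measure N A) =
        (\<integral>\<^sup>+z. ennreal (- ln (G (X z))) * indicator A z \<partial>N) / emeasure N A"
      using A by (intro nn_integral_uniform_measure) auto
    also have "\<dots> \<le> 1 / emeasure N A"
      by (intro divide_right_mono_ennreal order_trans[OF nn_integral_mono nn])
        (auto simp: indicator_def)
    also have "\<dots> = ennreal (1 / al)"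
      using al by (simp add: emA divide_ennreal[symmetric])
    also have "\<dots> \<le> ennreal (1 / a)"
      using a al by (intro ennreal_leI frac_le) auto
    finally show ?thesis .
  qed
  have I: "integrable (uniform_measure N A) (\<lambda>z. ln (G (X z)))"
  proof (rule integrableI_bounded)
    have "(\<integral>\<^sup>+z. ennreal (norm (ln (G (X z)))) \<partial>uniform_measure N A) =
        (\<integral>\<^sup>+z. ennreal (- ln (G (X z))) \<partial>uniform_measure N A)"
      by (rule nn_integral_cong_AE) (use posV G01 in \<open>auto elim!: eventually_mono\<close>)
    also have "\<dots> < \<infinity>" using nnV by (simp add: order_le_less_trans)
    finally show "(\<integral>\<^sup>+z. ennreal (norm (ln (G (X z)))) \<partial>uniform_measure N A) < \<infinity>" .
  qed simp
  have "- V.expectation (\<lambda>z. ln (G (X z))) = V.expectation (\<lambda>z. - ln (G (X z)))" by simp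
  also have "\<dots> \<le> 1 / a"
  proof -
    have "ennreal (V.expectation (\<lambda>z. - ln (G (X z)))) =
        (\<integral>\<^sup>+z. ennreal (- ln (G (X z))) \<partial>uniform_measure N A)"
      using I posV G01 by (intro nn_integral_eq_integral[symmetric]) (auto elim!: eventually_mono)
    with nnV have "ennreal (V.expectation (\<lambda>z. - ln (G (X z)))) \<le> ennreal (1 / a)" by simp
    then show ?thesis using a by (subst (asm) ennreal_le_iff) auto
  qed
  finally have "exp (- (1 / a)) \<le> exp (V.expectation (\<lambda>z. ln (G (X z))))" by simp
  also have "\<dots> \<le> G (V.expectation X)"
  proof (rule V.log_concave_jensen[OF _ uscG _ I posV])
    show "log_concave_fun G" using halfspace_lc[of u] by (simp add: G_def[abs_def] X_def)
    show "integrable (uniform_measure N A) X" using Z unfolding X_def by simp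
  qed
  also have "V.expectation X = u \<bullet> y" unfolding X_def y_def using Z by simp
  finally show ?thesis by (simp add: G_def X_def)
qed

text \<open>The factor \<open>(f y / f z)\<^sup>d\<close> lost by the contraction averages to at least 1 over \<open>A\<close>, since
  \<open>exp x \<ge> 1 + x\<close> and \<open>ln f y\<close> is at least the mean of \<open>ln f\<close>.\<close>

lemma measure_contract_to_centroid:
  assumes A: "A \<in> sets borel" "bounded A" "0 < measure N A"
    and B: "\<And>x. f x \<le> B" and c: "0 < c" "\<And>x. x \<in> A \<Longrightarrow> c \<le> f x"
    and d: "0 < d" "d < 1"
  defines "y \<equiv> (\<integral>z. z \<partial>uniform_measure N A)"
  assumes S: "S \<in> sets borel" "\<And>z. z \<in> A \<Longrightarrow> (1 - d) *\<^sub>R z + d *\<^sub>R y \<in> S"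
  shows "(1 - d) ^ DIM('a) * measure N A \<le> measure N S"
proof -
  define al where "al = measure N A"
  have al: "0 < al" using A by (auto simp: al_def)
  have emA: "emeasure N A = ennreal al" by (simp add: al_def emeasure_eq_measure)
  interpret V: prob_space "uniform_measure N A"
    by (rule prob_space_uniform_measure) (use al in \<open>auto simp: emA\<close>)
  obtain R where R: "\<And>z. z \<in> A \<Longrightarrow> norm z \<le> R" using A(2) by (auto simp: bounded_iff)
  have AEA: "AE z in uniform_measure N A. z \<in> A"
    by (rule AE_uniform_measureI) (use A in auto)
  have Z: "integrable (uniform_measure N A) (\<lambda>z. z)"
    by (rule V.integrable_const_bound[of _ R]) (use AEA R in auto)
  have fpos: "0 < f z" if "z \<in> A" for z using c(2)[OF that] c(1) by simp
  have lnb: "\<bar>ln (f z)\<bar> \<le> \<bar>ln c\<bar> + \<bar>ln B\<bar>" if "z \<in> A" for z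
  proof -
    have "ln c \<le> ln (f z)" "ln (f z) \<le> ln B"
      using c(1) c(2)[OF that] B[of z] fpos[OF that] by (auto intro!: ln_mono)
    then show ?thesis by linarith
  qed
  have I: "integrable (uniform_measure N A) (\<lambda>z. ln (f z))"
    by (rule V.integrable_const_bound[of _ "\<bar>ln c\<bar> + \<bar>ln B\<bar>"]) (use AEA lnb in auto)
  have "exp (V.expectation (\<lambda>z. ln (f z))) \<le> f y"
    unfolding y_def
    by (rule V.log_concave_jensen[OF lc usc Z I]) (use AEA fpos in auto)
  moreover from this have fy: "0 < f y" by (rule less_le_trans[OF exp_gt_zero])
  ultimately have Ly: "V.expectation (\<lambda>z. ln (f z)) \<le> ln (f y)" by (simp add: ln_ge_iff)
  define h where "h z = 1 + d * (ln (f y) - ln (f z))" for z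
  have Ih: "integrable (uniform_measure N A) h" unfolding h_def using I by simp
  have "V.prob UNIV = 1"
    using V.prob_space by (simp only: space_uniform_measure space_density space_lborel space_borel)
  then have "V.expectation h = 1 + d * (ln (f y) - V.expectation (\<lambda>z. ln (f z)))"
    unfolding h_def using I by simp
  then have Eh: "1 \<le> V.expectation h" using Ly d by simp
  have "ennreal al \<le> ennreal al * (\<integral>\<^sup>+z. ennreal (h z) \<partial>uniform_measure N A)"
  proof -
    have "ennreal 1 \<le> ennreal (V.expectation h)" using Eh by (rule ennreal_leI)
    \<comment> \<open>\<open>h\<close> is negative where \<open>f z\<close> is much larger than
      \<open>f y\<close>. Truncating at 0 only raises the mean and agrees with what
      \<open>ennreal\<close> does.\<close>
    also have "\<dots> \<le> ennreal (V.expectation (\<lambda>z. max 0 (h z)))"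
      using Ih by (intro ennreal_leI integral_mono) auto
    also have "\<dots> = (\<integral>\<^sup>+z. ennreal (max 0 (h z)) \<partial>uniform_measure N A)"
      using Ih by (intro nn_integral_eq_integral[symmetric]) auto
    also have "\<dots> = (\<integral>\<^sup>+z. ennreal (h z) \<partial>uniform_measure N A)"
      by (intro nn_integral_cong) (auto simp: max_def ennreal_neg)
    finally have "ennreal al * 1 \<le> ennreal al * (\<integral>\<^sup>+z. ennreal (h z) \<partial>uniform_measure N A)"
      by (intro mult_left_mono) auto
    then show ?thesis by simp
  qed
  also have "\<dots> = (\<integral>\<^sup>+z. ennreal (h z) * indicator A z \<partial>N)"
  proof -
    have [measurable]: "h \<in> borel_measurable borel" unfolding h_def by measurable
    have "ennreal al * (x / ennreal al) = x" for x
      using al by (simp add: ennreal_times_divide mult.commute[of "ennreal al"] mult_divide_eq_ennreal)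
    then show ?thesis
      using A by (subst nn_integral_uniform_measure) (auto simp: emA)
  qed
  also have "\<dots> = (\<integral>\<^sup>+z. ennreal (f z) * (ennreal (h z) * indicator A z) \<partial>lborel)"
    using A by (intro nn_integral_density) (auto simp: h_def)
  also have "\<dots> \<le> (\<integral>\<^sup>+z. ennreal (f (d *\<^sub>R y + (1 - d) *\<^sub>R z)) * indicator S (d *\<^sub>R y + (1 - d) *\<^sub>R z) \<partial>lborel)"
  proof (intro nn_integral_mono)
    fix z
    show "ennreal (f z) * (ennreal (h z) * indicator A z) \<le>
      ennreal (f (d *\<^sub>R y + (1 - d) *\<^sub>R z)) * indicator S (d *\<^sub>R y + (1 - d) *\<^sub>R z)"
    proof (cases "z \<in> A")
      case True
      \<comment> \<open>The exponential is \<open>(f y / f z) powr d\<close>; multiplied by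
        \<open>f z\<close> it becomes the geometric mean that log-concavity bounds.\<close>
      have "f z * h z \<le> f z * exp (d * (ln (f y) - ln (f z)))"
        unfolding h_def using exp_ge_add_one_self by (intro mult_left_mono) auto
      also have "\<dots> = f z powr (1 - d) * f y powr d"
      proof -
        have "f z * exp (d * (ln (f y) - ln (f z))) = exp (ln (f z) + d * (ln (f y) - ln (f z)))"
          using fpos[OF True] by (simp only: exp_add exp_ln)
        also have "ln (f z) + d * (ln (f y) - ln (f z)) = (1 - d) * ln (f z) + d * ln (f y)"
          by (simp add: algebra_simps)
        finally show ?thesis using fpos[OF True] fy by (simp add: powr_def exp_add)
      qed
      also have "\<dots> \<le> f (d *\<^sub>R y + (1 - d) *\<^sub>R z)"
        using log_concave_funD[OF lc, of "1 - d" z y] d by (simp add: add.commute)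
      finally show ?thesis using True S(2)[OF True]
        by (simp add: ennreal_mult'[symmetric] ennreal_leI add.commute)
    qed simp
  qed
  finally have "ennreal ((1 - d) ^ DIM('a)) * ennreal al \<le> ennreal ((1 - d) ^ DIM('a)) * \<dots>"
    by (rule mult_left_mono) simp
  also have "\<dots> = emeasure N S"
    unfolding emeasure_N[OF S(1)]
    using S(1) d nn_integral_lborel_affine[of "\<lambda>w. ennreal (f w) * indicator S w" "1 - d" "d *\<^sub>R y"]
    by simp
  finally show ?thesis
    using d al by (simp add: ennreal_mult[symmetric] emeasure_eq_measure al_def)
qed

text \<open>The strict upper bound on \<open>a\<close> leaves room to intersect the level set with a
  large ball and keep mass above \<open>a\<close>. The resulting \<open>A\<close> is compact, hence
  so is its contraction \<open>S\<close>, and the two centroid estimates apply to it.\<close>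

lemma deep_set:
  assumes a: "0 < a" "a < 1 - 3 ^ DIM('a) * exp (- (2 * t / 3))" and t: "0 \<le> t"
    and d: "0 < d" "d < 1"
  obtains S where "S \<in> sets borel" "(1 - d) ^ DIM('a) * a \<le> measure N S"
    "\<And>x u b. x \<in> S \<Longrightarrow> u \<bullet> x \<le> b \<Longrightarrow>
      d ^ DIM('a) * exp (- ((1 - d) * t)) * exp (- (1 / a)) \<le> measure N {w. u \<bullet> w \<le> b}"
proof -
  obtain B where B: "B > 0" "\<And>x. f x \<le> B"
    and tail: "\<And>t. measure N {x. f x < exp (- t) * B} \<le> 3 ^ DIM('a) * exp (- (2 * t / 3))"
    using level_set_tail by blast
  define L where "L = {x. exp (- t) * B \<le> f x}"
  have L: "closed L" unfolding L_def by (rule usc)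
  have "prob L = 1 - prob {x. f x < exp (- t) * B}"
    using prob_compl[of "{x. f x < exp (- t) * B}"]
    by (simp add: L_def Compl_eq_Diff_UNIV[symmetric] Collect_neg_eq[symmetric] not_less)
  then have "a < prob L" using tail[of t] a by simp
  moreover have "(\<lambda>k. prob (L \<inter> cball 0 (real k))) \<longlonglongrightarrow> prob (\<Union>k. L \<inter> cball 0 (real k))"
    using L by (intro finite_Lim_measure_incseq) (auto simp: incseq_def)
  moreover have "(\<Union>k. L \<inter> cball 0 (real k)) = L" using real_arch_simple by auto
  ultimately have "\<forall>\<^sub>F k in sequentially. a < prob (L \<inter> cball 0 (real k))"
    by (intro order_tendstoD) auto
  then obtain k where k: "a < prob (L \<inter> cball 0 (real k))" by (auto simp: eventually_sequentially)
  define A where "A = L \<inter> cball 0 (real k)"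
  have cA: "compact A" using L by (simp add: A_def closed_Int_compact)
  then have A: "A \<in> sets borel" "bounded A" by (auto simp: compact_imp_bounded borel_compact)
  define y where "y = (\<integral>z. z \<partial>uniform_measure N A)"
  define S where "S = (\<lambda>z. (1 - d) *\<^sub>R z + d *\<^sub>R y) ` A"
  have "compact S" unfolding S_def by (intro compact_continuous_image cA continuous_intros)
  then have S: "S \<in> sets borel" by (rule borel_compact)
  show thesis
  proof (rule that[OF S])
    have "(1 - d) ^ DIM('a) * a \<le> (1 - d) ^ DIM('a) * measure N A"
      using k d by (intro mult_left_mono) (auto simp: A_def)
    also have "\<dots> \<le> measure N S"
      using A a k B d S
      by (intro measure_contract_to_centroid[where c = "exp (- t) * B" and B = B])
        (auto simp: A_def L_def S_def y_def)
    finally show "(1 - d) ^ DIM('a) * a \<le> measure N S" .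
  next
    fix x u b assume "x \<in> S" and x: "u \<bullet> x \<le> b"
    then obtain z where z: "z \<in> A" "x = (1 - d) *\<^sub>R z + d *\<^sub>R y" by (auto simp: S_def)
    have "exp (- (1 / a)) \<le> measure N {w. u \<bullet> w \<le> u \<bullet> y}"
      unfolding y_def using A a k by (intro depth_centroid) (auto simp: A_def)
    then have "d ^ DIM('a) * exp (- ((1 - d) * t)) * exp (- (1 / a)) \<le>
        d ^ DIM('a) * exp (- ((1 - d) * t)) * measure N {w. u \<bullet> w \<le> u \<bullet> y}"
      using d by (intro mult_left_mono) auto
    also have "\<dots> \<le> measure N {w. u \<bullet> w \<le> b}"
      using depth_interpolate[OF B _ t d, of z u y b] z x by (auto simp: A_def L_def)
    finally show "d ^ DIM('a) * exp (- ((1 - d) * t)) * exp (- (1 / a)) \<le> measure N {w. u \<bullet> w \<le> b}" .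
  qed
qed

end

section \<open>A one-dimensional Prekopa-Leindler inequality\<close>

text \<open>Fubini on the region under the graph. Levels are measured as fractions \<open>s\<close>
  of \<open>m\<close>, so that functions with different maxima can be compared at equal
  \<open>s\<close>; only levels up to \<open>m\<close> are counted, hence the truncation
  \<open>min m (g w)\<close>.\<close>

lemma nn_integral_layer_cake_Icc:
  fixes g :: "real \<Rightarrow> real"
  assumes [measurable]: "g \<in> borel_measurable borel" and g: "\<And>w. 0 \<le> g w" and m: "0 < m"
  shows "ennreal m * (\<integral>\<^sup>+s. emeasure lborel {w \<in> {0..L}. s * m \<le> g w} * indicator {0<..1} s \<partial>lborel) =
    (\<integral>\<^sup>+w. ennreal (min m (g w)) * indicator {0..L} w \<partial>lborel)"
proof -
  let ?P = "\<lambda>s w. indicator {(s, w). 0 < s \<and> s \<le> 1 \<and> 0 \<le> w \<and> w \<le> L \<and> s * m \<le> g w} (s, w) :: ennreal"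
  have [measurable]: "(\<lambda>(s, w). ?P s w) \<in> borel_measurable (lborel \<Otimes>\<^sub>M lborel)"
    by measurable
  have 1: "(\<integral>\<^sup>+w. ?P s w \<partial>lborel) = emeasure lborel {w \<in> {0..L}. s * m \<le> g w} * indicator {0<..1} s" for s
  proof -
    have "(\<integral>\<^sup>+w. ?P s w \<partial>lborel) = (\<integral>\<^sup>+w. indicator {0<..1} s * indicator {w \<in> {0..L}. s * m \<le> g w} w \<partial>lborel)"
      by (intro nn_integral_cong) (auto simp: indicator_def)
    then show ?thesis by (subst (asm) nn_integral_cmult) (auto simp: mult.commute)
  qed
  have 2: "ennreal m * (\<integral>\<^sup>+s. ?P s w \<partial>lborel) = ennreal (min m (g w)) * indicator {0..L} w" for w
  proof -
    have "(\<integral>\<^sup>+s. ?P s w \<partial>lborel) = (\<integral>\<^sup>+s. indicator {0..L} w * indicator {0<..min 1 (g w / m)} s \<partial>lborel)"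
      using m by (intro nn_integral_cong) (auto simp: indicator_def field_simps)
    also have "\<dots> = indicator {0..L} w * ennreal (min 1 (g w / m))"
      using g[of w] m by (subst nn_integral_cmult) auto
    also have "ennreal m * \<dots> = ennreal (m * min 1 (g w / m)) * indicator {0..L} w"
      using g[of w] m by (simp add: ennreal_mult ac_simps)
    also have "m * min 1 (g w / m) = min m (g w)" using m by (simp add: min_def field_simps)
    finally show ?thesis .
  qed
  have "ennreal m * (\<integral>\<^sup>+s. emeasure lborel {w \<in> {0..L}. s * m \<le> g w} * indicator {0<..1} s \<partial>lborel) =
      ennreal m * (\<integral>\<^sup>+w. (\<integral>\<^sup>+s. ?P s w \<partial>lborel) \<partial>lborel)"
    using lborel_pair.Fubini'[of ?P] by (simp add: 1)
  also have "\<dots> = (\<integral>\<^sup>+w. ennreal m * (\<integral>\<^sup>+s. ?P s w \<partial>lborel) \<partial>lborel)"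
    by (rule nn_integral_cmult[symmetric]) measurable
  finally show ?thesis by (simp add: 2)
qed

text \<open>Superlevel sets of decreasing functions on \<open>{0..L}\<close> are intervals starting at \<open>0\<close>, so the
  one-dimensional Brunn-Minkowski inequality between them is trivial.\<close>

lemma prekopa_leindler_antimono:
  fixes g1 g2 h :: "real \<Rightarrow> real"
  assumes mono: "antimono g1" "antimono g2" "antimono h"
    and nonneg: "\<And>x. 0 \<le> g1 x" "\<And>x. 0 \<le> g2 x" "\<And>x. 0 \<le> h x"
    and t: "0 < t" "t < 1" and L: "0 \<le> L"
    and le: "\<And>x y. g1 x powr t * g2 y powr (1 - t) \<le> h (t * x + (1 - t) * y)"
    and I: "(\<integral>\<^sup>+w. ennreal (g1 w) * indicator {0..L} w \<partial>lborel) = ennreal I1" "0 \<le> I1"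
      "(\<integral>\<^sup>+w. ennreal (g2 w) * indicator {0..L} w \<partial>lborel) = ennreal I2" "0 \<le> I2"
      "(\<integral>\<^sup>+w. ennreal (h w) * indicator {0..L} w \<partial>lborel) = ennreal I3" "0 \<le> I3"
  shows "I1 powr t * I2 powr (1 - t) \<le> I3"
proof (cases "0 < I1 \<and> 0 < I2")
  case False
  then have "I1 = 0 \<or> I2 = 0" using I by auto
  then show ?thesis using I t by auto
next
  case True
  have [measurable]: "g1 \<in> borel_measurable borel" "g2 \<in> borel_measurable borel" "h \<in> borel_measurable borel"
    using mono borel_measurable_mono[of "\<lambda>x. - g1 x"] borel_measurable_mono[of "\<lambda>x. - g2 x"]
      borel_measurable_mono[of "\<lambda>x. - h x"]
    by (auto simp: mono_def antimono_def)
  have pos: "0 < g 0" if "antimono g" "\<And>x. 0 \<le> g x"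
    "(\<integral>\<^sup>+w. ennreal (g w) * indicator {0..L} w \<partial>lborel) = ennreal J" "0 < J" for g :: "real \<Rightarrow> real" and J
  proof (rule ccontr)
    assume "\<not> 0 < g 0"
    then have "g w \<le> 0" if "0 \<le> w" for w
      using antimonoD[OF \<open>antimono g\<close> that] by linarith
    then have "ennreal (g w) * indicator {0..L} w = 0" for w
      by (simp add: indicator_def ennreal_neg)
    then have "(\<integral>\<^sup>+w. ennreal (g w) * indicator {0..L} w \<partial>lborel) = 0" by (simp only: nn_integral_const mult_zero_left)
    then show False using that(3,4) by simp
  qed
  \<comment> \<open>The functions are decreasing, so their maxima on \<open>{0..L}\<close> are the
    values at 0. Relative to these, levels \<open>s * m1\<close> and \<open>s * m2\<close> combine
    to \<open>s * m\<close>, and both superlevel sets contain 0 for every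
    \<open>s \<le> 1\<close>.\<close>
  define m1 where "m1 = g1 0"
  define m2 where "m2 = g2 0"
  define m where "m = m1 powr t * m2 powr (1 - t)"
  have m: "0 < m1" "0 < m2" "0 < m"
    using pos[OF mono(1) nonneg(1) I(1)] pos[OF mono(2) nonneg(2) I(3)] True
    by (auto simp: m1_def m2_def m_def)
  define A1 where "A1 s = {w \<in> {0..L}. s * m1 \<le> g1 w}" for s
  define A2 where "A2 s = {w \<in> {0..L}. s * m2 \<le> g2 w}" for s
  define A where "A s = {w \<in> {0..L}. s * m \<le> h w}" for s
  have [measurable]: "A1 s \<in> sets borel" "A2 s \<in> sets borel" "A s \<in> sets borel" for s
    by (simp_all add: A1_def A2_def A_def)
  have sub: "{0..t * a + (1 - t) * b} \<subseteq> A s" if s: "0 < s" and a: "a \<in> A1 s" and b: "b \<in> A2 s" for a b s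
  proof
    fix x assume x: "x \<in> {0..t * a + (1 - t) * b}"
    have ab: "0 \<le> a" "a \<le> L" "0 \<le> b" "b \<le> L" "s * m1 \<le> g1 a" "s * m2 \<le> g2 b"
      using a b by (auto simp: A1_def A2_def)
    have "t * a + (1 - t) * b \<le> L"
      using convex_bound_le[of a L b t "1 - t"] ab t by simp
    moreover have "s * m \<le> h x"
    proof -
      have "s * m = (s * m1) powr t * (s * m2) powr (1 - t)"
      proof -
        have "s powr t * s powr (1 - t) = s" using s by (simp add: powr_add[symmetric])
        then show ?thesis by (simp add: m_def powr_mult mult_ac)
      qed
      also have "\<dots> \<le> g1 a powr t * g2 b powr (1 - t)"
        using ab t s m by (intro mult_mono powr_mono2) auto
      also have "\<dots> \<le> h (t * a + (1 - t) * b)" by (rule le)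
      also have "\<dots> \<le> h x" using mono(3) x by (auto simp: antimono_def)
      finally show ?thesis .
    qed
    ultimately show "x \<in> A s" using x by (auto simp: A_def)
  qed
  \<comment> \<open>The interval need not contain its right end \<open>Sup S\<close>: its length is
    at most \<open>Sup S\<close>, and points of \<open>S\<close> come arbitrarily close to
    it.\<close>
  have interval: "\<exists>al\<ge>0. emeasure lborel S \<le> ennreal al \<and> (\<forall>e>0. \<exists>a\<in>S. al - e < a)"
    if "0 \<in> S" "S \<subseteq> {0..L}" for S :: "real set"
  proof -
    have bdd: "bdd_above S" using that(2) by (meson bdd_above_Icc bdd_above_mono)
    have "S \<subseteq> {0..Sup S}" using that(2) cSup_upper[OF _ bdd] by auto
    moreover have "0 \<le> Sup S" using cSup_upper[OF that(1) bdd] .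
    ultimately have "emeasure lborel S \<le> ennreal (Sup S)"
      using emeasure_mono[of S "{0..Sup S}" lborel] by simp
    moreover have "\<exists>a\<in>S. Sup S - e < a" if "0 < e" for e
      using less_cSup_iff[OF _ bdd, of "Sup S - e"] \<open>0 \<in> S\<close> that by auto
    ultimately show ?thesis using \<open>0 \<le> Sup S\<close> by blast
  qed
  have level: "ennreal t * emeasure lborel (A1 s) + ennreal (1 - t) * emeasure lborel (A2 s) \<le> emeasure lborel (A s)"
    if s: "0 < s" "s \<le> 1" for s
  proof -
    have "0 \<in> A1 s" "0 \<in> A2 s" using s L m by (auto simp: A1_def A2_def m1_def m2_def mult_left_le_one_le)
    moreover have "A1 s \<subseteq> {0..L}" "A2 s \<subseteq> {0..L}" by (auto simp: A1_def A2_def)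
    ultimately obtain al be where al: "0 \<le> al" "emeasure lborel (A1 s) \<le> ennreal al" "\<And>e. 0 < e \<Longrightarrow> \<exists>a\<in>A1 s. al - e < a"
      and be: "0 \<le> be" "emeasure lborel (A2 s) \<le> ennreal be" "\<And>e. 0 < e \<Longrightarrow> \<exists>a\<in>A2 s. be - e < a"
      using interval by metis
    have approx: "ennreal (t * al + (1 - t) * be) \<le> emeasure lborel (A s) + ennreal e" if e: "0 < e" for e
    proof -
      obtain a b where ab: "a \<in> A1 s" "al - e < a" "b \<in> A2 s" "be - e < b"
        using al(3)[OF e] be(3)[OF e] by blast
      have "t * (al - e) + (1 - t) * (be - e) \<le> t * a + (1 - t) * b"
        using ab t by (intro add_mono mult_left_mono) auto
      then have "t * al + (1 - t) * be \<le> t * a + (1 - t) * b + e" by (simp add: algebra_simps)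
      then have "ennreal (t * al + (1 - t) * be) \<le> ennreal (t * a + (1 - t) * b + e)" by (rule ennreal_leI)
      also have "\<dots> = ennreal (t * a + (1 - t) * b) + ennreal e"
        using ab t e by (intro ennreal_plus) (auto simp: A1_def A2_def)
      also have "ennreal (t * a + (1 - t) * b) = emeasure lborel {0..t * a + (1 - t) * b}"
        using ab t by (subst emeasure_lborel_Icc) (auto simp: A1_def A2_def)
      also have "\<dots> \<le> emeasure lborel (A s)"
        using sub[OF s(1) ab(1,3)] by (intro emeasure_mono) auto
      finally show ?thesis by (simp add: add_right_mono)
    qed
    have "ennreal (t * al + (1 - t) * be) \<le> emeasure lborel (A s)"
      by (rule ennreal_le_epsilon) (rule approx)
    moreover have "ennreal t * emeasure lborel (A1 s) + ennreal (1 - t) * emeasure lborel (A2 s) \<le> ennreal t * ennreal al + ennreal (1 - t) * ennreal be"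
      using al be by (intro add_mono mult_left_mono) auto
    moreover have "ennreal t * ennreal al + ennreal (1 - t) * ennreal be = ennreal (t * al + (1 - t) * be)"
      using al be t by (simp add: ennreal_mult)
    ultimately show ?thesis by simp
  qed
  have J: "(\<integral>\<^sup>+s. emeasure lborel {w \<in> {0..L}. s * g 0 \<le> g w} * indicator {0<..1} s \<partial>lborel) = ennreal (J / g 0)"
    if g: "antimono g" "\<And>x. 0 \<le> g x" "g \<in> borel_measurable borel" "0 < g 0" and J: "0 \<le> J"
      "(\<integral>\<^sup>+w. ennreal (g w) * indicator {0..L} w \<partial>lborel) = ennreal J" for g :: "real \<Rightarrow> real" and J
  proof -
    \<comment> \<open>The truncation of the layer-cake formula has no effect, because
      \<open>g\<close> does not exceed \<open>g 0\<close> on \<open>{0..L}\<close>.\<close>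
    have "ennreal (min (g 0) (g w)) * indicator {0..L} w = ennreal (g w) * indicator {0..L} w" for w
      using g(1) by (auto simp: indicator_def antimono_def min_absorb2)
    then have eq: "ennreal (g 0) * (\<integral>\<^sup>+s. emeasure lborel {w \<in> {0..L}. s * g 0 \<le> g w} * indicator {0<..1} s \<partial>lborel) = ennreal J"
      using nn_integral_layer_cake_Icc[OF g(3,2,4), of L] J by simp
    have "ennreal (1 / g 0) * (ennreal (g 0) * c) = c" for c
      using g(4) by (simp add: mult.assoc[symmetric] ennreal_mult[symmetric])
    then show ?thesis
      using arg_cong[OF eq, of "\<lambda>c. ennreal (1 / g 0) * c"] g(4) J(1) by (simp add: ennreal_mult[symmetric])
  qed
  have "(\<lambda>s. emeasure lborel {w \<in> {0..L}. s * k \<le> g w}) \<in> borel_measurable borel"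
    if [measurable]: "g \<in> borel_measurable borel" for g :: "real \<Rightarrow> real" and k
  proof -
    have "emeasure lborel {w \<in> {0..L}. s * k \<le> g w} =
        (\<integral>\<^sup>+w. indicator {p. 0 \<le> snd p \<and> snd p \<le> L \<and> fst p * k \<le> g (snd p)} (s, w) \<partial>lborel)" for s
    proof -
      have "emeasure lborel {w \<in> {0..L}. s * k \<le> g w} =
          (\<integral>\<^sup>+w. indicator {w \<in> {0..L}. s * k \<le> g w} w \<partial>lborel)"
        by (rule nn_integral_indicator[symmetric]) simp
      also have "\<dots> = (\<integral>\<^sup>+w. indicator {p. 0 \<le> snd p \<and> snd p \<le> L \<and> fst p * k \<le> g (snd p)} (s, w) \<partial>lborel)"
        by (rule nn_integral_cong) (simp add: indicator_def)
      finally show ?thesis .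
    qed
    then show ?thesis by simp
  qed
  then have [measurable]: "(\<lambda>s. emeasure lborel (A1 s)) \<in> borel_measurable borel"
    "(\<lambda>s. emeasure lborel (A2 s)) \<in> borel_measurable borel"
    by (simp_all add: A1_def A2_def)
  have "ennreal (t * (I1 / m1) + (1 - t) * (I2 / m2)) =
      ennreal t * ennreal (I1 / m1) + ennreal (1 - t) * ennreal (I2 / m2)"
    using t m I by (subst ennreal_plus) (auto simp: ennreal_mult[symmetric])
  also have "\<dots> = ennreal t * (\<integral>\<^sup>+s. emeasure lborel (A1 s) * indicator {0<..1} s \<partial>lborel) +
      ennreal (1 - t) * (\<integral>\<^sup>+s. emeasure lborel (A2 s) * indicator {0<..1} s \<partial>lborel)"
    using J[OF mono(1) nonneg(1), of I1] J[OF mono(2) nonneg(2), of I2] m I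
    by (simp add: A1_def A2_def m1_def m2_def)
  also have "\<dots> = (\<integral>\<^sup>+s. ennreal t * (emeasure lborel (A1 s) * indicator {0<..1} s) +
      ennreal (1 - t) * (emeasure lborel (A2 s) * indicator {0<..1} s) \<partial>lborel)"
    by (subst nn_integral_add) (auto simp: nn_integral_cmult)
  also have "\<dots> \<le> (\<integral>\<^sup>+s. emeasure lborel (A s) * indicator {0<..1} s \<partial>lborel)"
    using level by (intro nn_integral_mono) (auto simp: indicator_def)
  finally have "ennreal m * ennreal (t * (I1 / m1) + (1 - t) * (I2 / m2)) \<le> ennreal m * \<dots>"
    by (rule mult_left_mono) simp
  also have "\<dots> = (\<integral>\<^sup>+w. ennreal (min m (h w)) * indicator {0..L} w \<partial>lborel)"
    unfolding A_def by (rule nn_integral_layer_cake_Icc) (use nonneg m in auto)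
  also have "\<dots> \<le> (\<integral>\<^sup>+w. ennreal (h w) * indicator {0..L} w \<partial>lborel)"
    by (intro nn_integral_mono mult_right_mono ennreal_leI) auto
  also have "\<dots> = ennreal I3" by (rule I)
  finally have "ennreal (m * (t * (I1 / m1) + (1 - t) * (I2 / m2))) \<le> ennreal I3"
    using m I t by (subst ennreal_mult) auto
  then have main: "m * (t * (I1 / m1) + (1 - t) * (I2 / m2)) \<le> I3"
    using I(6) by (simp only: ennreal_le_iff)
  have "I1 powr t * I2 powr (1 - t) = m * ((I1 / m1) powr t * (I2 / m2) powr (1 - t))"
    using m True by (simp add: m_def powr_divide)
  \<comment> \<open>The level-set inequality gives the weighted arithmetic mean of the normalised
    integrals, which dominates their geometric mean.\<close>
  also have "\<dots> \<le> m * (t * (I1 / m1) + (1 - t) * (I2 / m2))"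
    using m True t by (intro mult_left_mono Youngs_inequality_0) auto
  finally show ?thesis using main by simp
qed

text \<open>Substituting \<open>w - r\<close> or \<open>r - w\<close>, according to the sign of
  \<open>v\<close>, makes the integrand decreasing on an interval starting at 0 when
  \<open>G\<close> is increasing, the form required by
  \<open>prekopa_leindler_antimono\<close>.\<close>

lemma nn_integral_reflect_shift:
  fixes G :: "real \<Rightarrow> real"
  assumes [measurable]: "G \<in> borel_measurable borel"
  shows "(\<integral>\<^sup>+w. ennreal (G (c - w * v)) * indicator {- r..r} w \<partial>lborel) =
    (\<integral>\<^sup>+w. ennreal (G (c + r * \<bar>v\<bar> - w * \<bar>v\<bar>)) * indicator {0..2 * r} w \<partial>lborel)"
proof (cases "0 \<le> v")
  case True
  show ?thesis
    by (subst nn_integral_real_affine[of _ 1 "- r"])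
      (use True in \<open>auto intro!: nn_integral_cong simp: indicator_def algebra_simps\<close>)
next
  case False
  show ?thesis
    by (subst nn_integral_real_affine[of _ "- 1" r])
      (use False in \<open>auto intro!: nn_integral_cong simp: indicator_def algebra_simps\<close>)
qed

text \<open>The argument of \<open>G\<close> is affine in \<open>(c, w)\<close> jointly, so
  log-concavity of \<open>G\<close> supplies the hypothesis of
  \<open>prekopa_leindler_antimono\<close> for the integrands at \<open>x\<close>, \<open>y\<close>
  and their convex combination.\<close>

lemma log_concave_interval_average:
  fixes G :: "real \<Rightarrow> real"
  assumes G: "mono G" "log_concave_fun G" and r: "0 \<le> r"
  obtains Q where "mono Q" "log_concave_fun Q"
    "\<And>c. (\<integral>\<^sup>+w. ennreal (G (c - w * v)) * indicator {- r..r} w \<partial>lborel) = ennreal (Q c)"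
proof -
  have [measurable]: "G \<in> borel_measurable borel" using G(1) by (rule borel_measurable_mono)
  have nonneg: "0 \<le> G c" for c using G(2) by (rule log_concave_fun_nonneg)
  define I where "I c = (\<integral>\<^sup>+w. ennreal (G (c - w * v)) * indicator {- r..r} w \<partial>lborel)" for c
  define Q where "Q c = enn2real (I c)" for c
  define g where "g c w = G (c + r * \<bar>v\<bar> - w * \<bar>v\<bar>)" for c w
  have I_g: "I c = (\<integral>\<^sup>+w. ennreal (g c w) * indicator {0..2 * r} w \<partial>lborel)" for c
    unfolding I_def g_def by (rule nn_integral_reflect_shift) simp
  \<comment> \<open>Since \<open>G\<close> is increasing, the integrand is at most its value at
    \<open>w = 0\<close>, which makes the integral finite.\<close>
  have "I c \<le> (\<integral>\<^sup>+w. ennreal (g c 0) * indicator {0..2 * r} w \<partial>lborel)" for c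
    unfolding I_g g_def using G(1)
    by (intro nn_integral_mono) (auto simp: indicator_def mono_def intro!: ennreal_leI)
  also have "(\<integral>\<^sup>+w. ennreal (g c 0) * indicator {0..2 * r} w \<partial>lborel) < \<top>" for c
    using r by (subst nn_integral_cmult) (auto simp: ennreal_mult_less_top)
  finally have fin: "I c < \<top>" for c .
  then have I_Q: "I c = ennreal (Q c)" for c by (simp add: Q_def)
  have Q0: "0 \<le> Q c" for c by (simp add: Q_def)
  have g: "antimono (g c)" "0 \<le> g c w" "(\<integral>\<^sup>+w. ennreal (g c w) * indicator {0..2 * r} w \<partial>lborel) = ennreal (Q c)" for c w
    using G(1) nonneg I_Q[unfolded I_g] by (auto simp: g_def antimono_def mono_def mult_right_mono)
  have "I c \<le> I c'" if "c \<le> c'" for c c'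
    unfolding I_def using G(1) that
    by (intro nn_integral_mono mult_right_mono ennreal_leI) (auto simp: mono_def)
  then have "mono Q" unfolding mono_def Q_def using fin by (blast intro: enn2real_mono)
  moreover have "log_concave_fun Q"
  proof (rule log_concave_funI)
    show "0 \<le> Q x" for x by (rule Q0)
  next
    fix x y t :: real assume t: "0 < t" "t < 1"
    let ?z = "t *\<^sub>R x + (1 - t) *\<^sub>R y"
    show "Q x powr t * Q y powr (1 - t) \<le> Q ?z"
    proof (rule prekopa_leindler_antimono[of "g x" "g y" "g ?z" t "2 * r"])
      fix a b :: real
      have "g x a powr t * g y b powr (1 - t) \<le>
          G (t *\<^sub>R (x + r * \<bar>v\<bar> - a * \<bar>v\<bar>) + (1 - t) *\<^sub>R (y + r * \<bar>v\<bar> - b * \<bar>v\<bar>))"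
        unfolding g_def by (rule log_concave_funD[OF G(2) t])
      also have "t *\<^sub>R (x + r * \<bar>v\<bar> - a * \<bar>v\<bar>) + (1 - t) *\<^sub>R (y + r * \<bar>v\<bar> - b * \<bar>v\<bar>) =
          ?z + r * \<bar>v\<bar> - (t * a + (1 - t) * b) * \<bar>v\<bar>"
        by (simp add: algebra_simps)
      finally show "g x a powr t * g y b powr (1 - t) \<le> g ?z (t * a + (1 - t) * b)"
        by (simp add: g_def)
    qed (use t r Q0 g in auto)
  qed
  ultimately show thesis using I_Q unfolding I_def by (rule that)
qed

text \<open>Coordinates are integrated out one at a time. Monotonicity is carried through the
  induction because each one-dimensional average relies on it.\<close>

lemma log_concave_box_average_PiM:
  fixes G :: "real \<Rightarrow> real"
  assumes "finite S" and G: "mono G" "log_concave_fun G" and r: "0 \<le> r"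
  shows "\<exists>Q. mono Q \<and> log_concave_fun Q \<and> (\<forall>c.
    (\<integral>\<^sup>+g. ennreal (G (c - (\<Sum>i\<in>S. g i * v i))) * (\<Prod>i\<in>S. indicator {- r..r} (g i)) \<partial>PiM S (\<lambda>_. lborel)) = ennreal (Q c))"
  using \<open>finite S\<close>
proof induction
  case empty
  then show ?case using G by (intro exI[of _ G]) (simp add: PiM_empty)
next
  case (insert j S)
  interpret product_sigma_finite "\<lambda>_. lborel :: real measure" ..
  have [measurable]: "G \<in> borel_measurable borel" using G(1) by (rule borel_measurable_mono)
  obtain Q where Q: "mono Q" "log_concave_fun Q" and
    IQ: "\<And>c. (\<integral>\<^sup>+g. ennreal (G (c - (\<Sum>i\<in>S. g i * v i))) * (\<Prod>i\<in>S. indicator {- r..r} (g i)) \<partial>PiM S (\<lambda>_. lborel)) = ennreal (Q c)"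
    using insert.IH by blast
  obtain Q' where Q': "mono Q'" "log_concave_fun Q'" and
    IQ': "\<And>c. (\<integral>\<^sup>+w. ennreal (Q (c - w * v j)) * indicator {- r..r} w \<partial>lborel) = ennreal (Q' c)"
    using log_concave_interval_average[OF Q r] by blast
  have "(\<integral>\<^sup>+g. ennreal (G (c - (\<Sum>i\<in>insert j S. g i * v i))) * (\<Prod>i\<in>insert j S. indicator {- r..r} (g i)) \<partial>PiM (insert j S) (\<lambda>_. lborel)) = ennreal (Q' c)" for c
  proof -
    have [measurable]: "(\<lambda>g. ennreal (G (c - (\<Sum>i\<in>insert j S. g i * v i))) * (\<Prod>i\<in>insert j S. indicator {- r..r} (g i)))
        \<in> borel_measurable (PiM (insert j S) (\<lambda>_. lborel))"
      by measurable
    have "(\<integral>\<^sup>+g. ennreal (G (c - (\<Sum>i\<in>insert j S. g i * v i))) * (\<Prod>i\<in>insert j S. indicator {- r..r} (g i)) \<partial>PiM (insert j S) (\<lambda>_. lborel)) =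
      (\<integral>\<^sup>+w. (\<integral>\<^sup>+g. ennreal (G (c - (\<Sum>i\<in>insert j S. (g(j := w)) i * v i))) * (\<Prod>i\<in>insert j S. indicator {- r..r} ((g(j := w)) i)) \<partial>PiM S (\<lambda>_. lborel)) \<partial>lborel)"
      by (rule product_nn_integral_insert_rev) (use insert in auto)
    also have "\<dots> = (\<integral>\<^sup>+w. ennreal (Q (c - w * v j)) * indicator {- r..r} w \<partial>lborel)"
    proof (rule nn_integral_cong)
      fix w :: real
      have eq: "(\<Sum>i\<in>S. (g(j := w)) i * v i) = (\<Sum>i\<in>S. g i * v i)"
        "(\<Prod>i\<in>S. indicator {- r..r} ((g(j := w)) i)) = (\<Prod>i\<in>S. indicator {- r..r} (g i) :: ennreal)" for g
        using insert.hyps by (auto intro!: sum.cong prod.cong)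
      have "(\<integral>\<^sup>+g. ennreal (G (c - (\<Sum>i\<in>insert j S. (g(j := w)) i * v i))) * (\<Prod>i\<in>insert j S. indicator {- r..r} ((g(j := w)) i)) \<partial>PiM S (\<lambda>_. lborel)) =
        (\<integral>\<^sup>+g. ennreal (G ((c - w * v j) - (\<Sum>i\<in>S. g i * v i))) * (\<Prod>i\<in>S. indicator {- r..r} (g i)) * indicator {- r..r} w \<partial>PiM S (\<lambda>_. lborel))"
        using insert.hyps by (intro nn_integral_cong)
          (simp only: sum.insert prod.insert eq fun_upd_same diff_diff_eq mult.assoc mult.commute[of "indicator {- r..r} w"] not_False_eq_True)
      also have "\<dots> = ennreal (Q (c - w * v j)) * indicator {- r..r} w"
        by (subst nn_integral_multc) (auto simp: IQ)
      finally show "(\<integral>\<^sup>+g. ennreal (G (c - (\<Sum>i\<in>insert j S. (g(j := w)) i * v i))) * (\<Prod>i\<in>insert j S. indicator {- r..r} ((g(j := w)) i)) \<partial>PiM S (\<lambda>_. lborel)) =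
        ennreal (Q (c - w * v j)) * indicator {- r..r} w" .
    qed
    finally show ?thesis by (simp add: IQ')
  qed
  then show ?case using Q' by blast
qed

text \<open>Lebesgue measure is the image of the product measure under the coordinate expansion, and
  the indicator of the cube factorises over the coordinates.\<close>

lemma log_concave_box_average:
  fixes G :: "real \<Rightarrow> real" and u :: "'a::euclidean_space"
  assumes G: "mono G" "log_concave_fun G" and r: "0 \<le> r"
  obtains Q where "log_concave_fun Q"
    "\<And>c. (\<integral>\<^sup>+w. ennreal (G (c - u \<bullet> w)) * indicator (cbox (- r *\<^sub>R One) (r *\<^sub>R One)) w \<partial>lborel) = ennreal (Q c)"
proof -
  have [measurable]: "G \<in> borel_measurable borel" using G(1) by (rule borel_measurable_mono)
  obtain Q where Q: "log_concave_fun Q" and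
    IQ: "\<And>c. (\<integral>\<^sup>+g. ennreal (G (c - (\<Sum>i\<in>Basis. g i * (u \<bullet> i)))) * (\<Prod>i\<in>Basis. indicator {- r..r} (g i)) \<partial>PiM (Basis :: 'a set) (\<lambda>_. lborel)) = ennreal (Q c)"
    using log_concave_box_average_PiM[OF finite_Basis G r, of "\<lambda>i. u \<bullet> i"] by blast
  have "(\<integral>\<^sup>+w. ennreal (G (c - u \<bullet> w)) * indicator (cbox (- r *\<^sub>R One) (r *\<^sub>R One)) w \<partial>lborel) = ennreal (Q c)" for c
  proof -
    have "(\<integral>\<^sup>+w. ennreal (G (c - u \<bullet> w)) * indicator (cbox (- r *\<^sub>R One) (r *\<^sub>R One)) w \<partial>lborel) =
      (\<integral>\<^sup>+g. ennreal (G (c - u \<bullet> (\<Sum>b\<in>Basis. g b *\<^sub>R b))) * indicator (cbox (- r *\<^sub>R One) (r *\<^sub>R One)) (\<Sum>b\<in>Basis. g b *\<^sub>R b) \<partial>PiM (Basis :: 'a set) (\<lambda>_. lborel))"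
      by (subst lborel_eq, subst nn_integral_distr) auto
    also have "\<dots> = (\<integral>\<^sup>+g. ennreal (G (c - (\<Sum>i\<in>Basis. g i * (u \<bullet> i)))) * (\<Prod>i\<in>Basis. indicator {- r..r} (g i)) \<partial>PiM (Basis :: 'a set) (\<lambda>_. lborel))"
    proof (rule nn_integral_cong)
      fix g :: "'a \<Rightarrow> real"
      have "indicator (cbox (- r *\<^sub>R One) (r *\<^sub>R One)) (\<Sum>b\<in>Basis. g b *\<^sub>R b :: 'a) = (\<Prod>i\<in>(Basis::'a set). indicator {- r..r} (g i) :: ennreal)"
        by (auto simp: indicator_def mem_box prod_zero_iff)
      then show "ennreal (G (c - u \<bullet> (\<Sum>b\<in>Basis. g b *\<^sub>R b))) * indicator (cbox (- r *\<^sub>R One) (r *\<^sub>R One)) (\<Sum>b\<in>Basis. g b *\<^sub>R b) =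
         ennreal (G (c - (\<Sum>i\<in>Basis. g i * (u \<bullet> i)))) * (\<Prod>i\<in>Basis. indicator {- r..r} (g i))"
        by (simp add: inner_sum_right)
    qed
    finally show ?thesis by (simp add: IQ)
  qed
  with Q show thesis by (rule that)
qed

section \<open>Smoothing a log-concave measure\<close>

lemma log_concave_fun_scale:
  assumes f: "log_concave_fun f" and a: "0 \<le> a"
  shows "log_concave_fun (\<lambda>x. a * f x)"
proof (rule log_concave_funI)
  show "0 \<le> a * f x" for x using log_concave_fun_nonneg[OF f] a by simp
next
  fix x y and t :: real assume t: "0 < t" "t < 1" and pos: "0 < a * f x"
  then have a: "0 < a" using a by (metis less_eq_real_def mult_zero_left)
  have "(a * f x) powr t * (a * f y) powr (1 - t) = (a powr t * a powr (1 - t)) * (f x powr t * f y powr (1 - t))"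
    by (simp add: powr_mult)
  also have "a powr t * a powr (1 - t) = a" using a by (simp add: powr_add[symmetric])
  also have "a * (f x powr t * f y powr (1 - t)) \<le> a * f (t *\<^sub>R x + (1 - t) *\<^sub>R y)"
    using log_concave_funD[OF f t] a by (intro mult_left_mono) auto
  finally show "(a * f x) powr t * (a * f y) powr (1 - t) \<le> a * f (t *\<^sub>R x + (1 - t) *\<^sub>R y)" .
qed

lemma mem_cbox_One: "w \<in> cbox (- r *\<^sub>R One) (r *\<^sub>R One) \<longleftrightarrow> (\<forall>b\<in>Basis. \<bar>w \<bullet> b\<bar> \<le> r)"
  for w :: "'a::euclidean_space" and r :: real
  by (auto simp: mem_box abs_le_iff)

lemma mem_cbox_centered: "z \<in> cbox (x - r *\<^sub>R One) (x + r *\<^sub>R One) \<longleftrightarrow> (\<forall>b\<in>Basis. \<bar>z \<bullet> b - x \<bullet> b\<bar> \<le> r)"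
  for x z :: "'a::euclidean_space" and r :: real
proof -
  have "(x - r *\<^sub>R One) \<bullet> b = x \<bullet> b - r" "(x + r *\<^sub>R One) \<bullet> b = x \<bullet> b + r" if "b \<in> Basis" for b
    using that by (simp_all add: inner_diff_left inner_add_left)
  then show ?thesis unfolding mem_box by (auto simp: abs_le_iff)
qed

lemma norm_mem_cbox_One:
  fixes w :: "'a::euclidean_space" and r :: real
  assumes "w \<in> cbox (- r *\<^sub>R One) (r *\<^sub>R One)"
  shows "norm w \<le> DIM('a) * r"
proof -
  have "norm w \<le> (\<Sum>b\<in>Basis. \<bar>w \<bullet> b\<bar>)" by (rule norm_le_l1)
  also have "\<dots> \<le> (\<Sum>b\<in>(Basis :: 'a set). r)"
    using assms[unfolded mem_cbox_One] by (intro sum_mono) auto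
  finally show ?thesis by simp
qed

lemma emeasure_lborel_cbox_One:
  assumes "0 \<le> r"
  shows "emeasure lborel (cbox (- r *\<^sub>R One) (r *\<^sub>R One :: 'a::euclidean_space)) = ennreal ((2 * r) ^ DIM('a))"
proof -
  have One: "(c *\<^sub>R One :: 'a) \<bullet> b = c" if "b \<in> Basis" for b c
    using that by simp
  have "(\<Prod>b\<in>Basis. (r *\<^sub>R One - (- r *\<^sub>R One) :: 'a) \<bullet> b) = (\<Prod>b\<in>(Basis :: 'a set). 2 * r)"
  proof (rule prod.cong[OF refl])
    fix b :: 'a assume b: "b \<in> Basis"
    show "(r *\<^sub>R One - (- r *\<^sub>R One)) \<bullet> b = 2 * r"
      by (simp only: inner_diff_left One[OF b])
  qed
  moreover have "(- r *\<^sub>R One :: 'a) \<bullet> b \<le> (r *\<^sub>R One) \<bullet> b" if "b \<in> Basis" for b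
    using assms One[OF that, of r] One[OF that, of "- r"] by linarith
  ultimately show ?thesis by (subst emeasure_lborel_cbox) (simp_all only: prod_constant)
qed

locale log_concave_measure = prob_space M for M :: "('a::euclidean_space) measure" +
  assumes sets_M [measurable_cong, simp]: "sets M = sets borel"
    and concave: "compact A \<Longrightarrow> compact B \<Longrightarrow> 0 < t \<Longrightarrow> t < 1 \<Longrightarrow>
      measure M A powr t * measure M B powr (1 - t) \<le>
      measure M {t *\<^sub>R a + (1 - t) *\<^sub>R b | a b. a \<in> A \<and> b \<in> B}"
begin

lemma space_M [simp]: "space M = UNIV" using sets_eq_imp_space_eq[OF sets_M] by simp

text \<open>Replaces the Minkowski combination by any Borel superset, such as a half-space or a
  cube.\<close>

lemma concave_subset:
  assumes "compact A" "compact B" "0 < t" "t < 1" "C \<in> sets borel"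
    and "\<And>a b. a \<in> A \<Longrightarrow> b \<in> B \<Longrightarrow> t *\<^sub>R a + (1 - t) *\<^sub>R b \<in> C"
  shows "measure M A powr t * measure M B powr (1 - t) \<le> measure M C"
  by (rule order_trans[OF concave[OF assms(1-4)] finite_measure_mono]) (use assms(5,6) in auto)

text \<open>Half-spaces are not compact, so they are cut by balls of radius \<open>k\<close>;
  positivity of the limiting masses lets \<open>powr\<close> pass to the limit.\<close>

lemma log_concave_halfspace: "log_concave_fun (\<lambda>c. measure M {y. u \<bullet> y \<le> c})"
proof (rule log_concave_funI)
  fix c1 c2 t :: real
  assume t: "0 < t" "t < 1" and pos: "0 < measure M {y. u \<bullet> y \<le> c1}" "0 < measure M {y. u \<bullet> y \<le> c2}"
  have lim: "(\<lambda>k. measure M ({y. u \<bullet> y \<le> c} \<inter> cball 0 (real k))) \<longlonglongrightarrow> measure M {y. u \<bullet> y \<le> c}" for c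
  proof -
    have "(\<lambda>k. measure M ({y. u \<bullet> y \<le> c} \<inter> cball 0 (real k))) \<longlonglongrightarrow> measure M (\<Union>k. {y. u \<bullet> y \<le> c} \<inter> cball 0 (real k))"
      by (intro finite_Lim_measure_incseq) (auto simp: incseq_def)
    also have "(\<Union>k. {y. u \<bullet> y \<le> c} \<inter> cball 0 (real k)) = {y. u \<bullet> y \<le> c}" using real_arch_simple by auto
    finally show ?thesis .
  qed
  show "measure M {y. u \<bullet> y \<le> c1} powr t * measure M {y. u \<bullet> y \<le> c2} powr (1 - t)
    \<le> measure M {y. u \<bullet> y \<le> t *\<^sub>R c1 + (1 - t) *\<^sub>R c2}"
  proof (rule LIMSEQ_le_const2)
    show "(\<lambda>k. measure M ({y. u \<bullet> y \<le> c1} \<inter> cball 0 (real k)) powr t * measure M ({y. u \<bullet> y \<le> c2} \<inter> cball 0 (real k)) powr (1 - t))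
      \<longlonglongrightarrow> measure M {y. u \<bullet> y \<le> c1} powr t * measure M {y. u \<bullet> y \<le> c2} powr (1 - t)"
      using pos by (intro tendsto_intros lim) auto
  next
    have "measure M ({y. u \<bullet> y \<le> c1} \<inter> cball 0 (real k)) powr t * measure M ({y. u \<bullet> y \<le> c2} \<inter> cball 0 (real k)) powr (1 - t)
      \<le> measure M {y. u \<bullet> y \<le> t *\<^sub>R c1 + (1 - t) *\<^sub>R c2}" for k
    proof (rule concave_subset)
      fix a b assume "a \<in> {y. u \<bullet> y \<le> c1} \<inter> cball 0 (real k)" "b \<in> {y. u \<bullet> y \<le> c2} \<inter> cball 0 (real k)"
      then have "t * (u \<bullet> a) + (1 - t) * (u \<bullet> b) \<le> t * c1 + (1 - t) * c2"
        using t by (intro add_mono mult_left_mono) auto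
      then show "t *\<^sub>R a + (1 - t) *\<^sub>R b \<in> {y. u \<bullet> y \<le> t *\<^sub>R c1 + (1 - t) *\<^sub>R c2}"
        by (simp add: inner_add_right)
    qed (use t in \<open>auto intro!: closed_Int_compact closed_halfspace_le\<close>)
    then show "\<exists>K. \<forall>k\<ge>K. measure M ({y. u \<bullet> y \<le> c1} \<inter> cball 0 (real k)) powr t * measure M ({y. u \<bullet> y \<le> c2} \<inter> cball 0 (real k)) powr (1 - t)
      \<le> measure M {y. u \<bullet> y \<le> t *\<^sub>R c1 + (1 - t) *\<^sub>R c2}" by blast
  qed
qed auto

text \<open>The density of the convolution of \<open>M\<close> with the uniform distribution on \<open>[-r, r]\<^sup>n\<close>.\<close>

definition smooth :: "real \<Rightarrow> 'a \<Rightarrow> real" where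
  "smooth r x = (1 / (2 * r) ^ DIM('a)) * measure M (cbox (x - r *\<^sub>R One) (x + r *\<^sub>R One))"

text \<open>Convex combinations of points in the cubes around \<open>x\<close> and \<open>y\<close>
  stay in the cube of the same size around the combined centre.\<close>

lemma log_concave_smooth: "0 < r \<Longrightarrow> log_concave_fun (smooth r)"
  unfolding smooth_def[abs_def]
proof (rule log_concave_fun_scale, rule log_concave_funI)
  fix x y :: 'a and t :: real assume t: "0 < t" "t < 1"
  show "measure M (cbox (x - r *\<^sub>R One) (x + r *\<^sub>R One)) powr t * measure M (cbox (y - r *\<^sub>R One) (y + r *\<^sub>R One)) powr (1 - t)
    \<le> measure M (cbox (t *\<^sub>R x + (1 - t) *\<^sub>R y - r *\<^sub>R One) (t *\<^sub>R x + (1 - t) *\<^sub>R y + r *\<^sub>R One))"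
  proof (rule concave_subset)
    fix a b
    assume ab: "a \<in> cbox (x - r *\<^sub>R One) (x + r *\<^sub>R One)" "b \<in> cbox (y - r *\<^sub>R One) (y + r *\<^sub>R One)"
    show "t *\<^sub>R a + (1 - t) *\<^sub>R b \<in> cbox (t *\<^sub>R x + (1 - t) *\<^sub>R y - r *\<^sub>R One) (t *\<^sub>R x + (1 - t) *\<^sub>R y + r *\<^sub>R One)"
      unfolding mem_cbox_centered
    proof
      fix i :: 'a assume i: "i \<in> Basis"
      have "\<bar>a \<bullet> i - x \<bullet> i\<bar> \<le> r" "\<bar>b \<bullet> i - y \<bullet> i\<bar> \<le> r"
        using ab i unfolding mem_cbox_centered by blast+
      then have "t * \<bar>a \<bullet> i - x \<bullet> i\<bar> + (1 - t) * \<bar>b \<bullet> i - y \<bullet> i\<bar> \<le> t * r + (1 - t) * r"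
        using t by (intro add_mono mult_left_mono) auto
      moreover have "\<bar>t * (a \<bullet> i - x \<bullet> i) + (1 - t) * (b \<bullet> i - y \<bullet> i)\<bar> \<le>
          t * \<bar>a \<bullet> i - x \<bullet> i\<bar> + (1 - t) * \<bar>b \<bullet> i - y \<bullet> i\<bar>"
        using abs_triangle_ineq[of "t * (a \<bullet> i - x \<bullet> i)" "(1 - t) * (b \<bullet> i - y \<bullet> i)"] t
        by (simp add: abs_mult)
      ultimately show "\<bar>(t *\<^sub>R a + (1 - t) *\<^sub>R b) \<bullet> i - (t *\<^sub>R x + (1 - t) *\<^sub>R y) \<bullet> i\<bar> \<le> r"
        by (simp add: inner_add_left algebra_simps)
    qed
  qed (use t in auto)
qed auto

text \<open>Cubes centred near \<open>l\<close> lie in slightly larger cubes around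
  \<open>l\<close>, and these decrease to the closed cube itself.\<close>

lemma usc_smooth:
  assumes r: "0 < r"
  shows "closed {x. c \<le> smooth r x}"
  unfolding closed_sequential_limits
proof (intro allI impI)
  fix x :: "nat \<Rightarrow> 'a" and l
  assume h: "(\<forall>n. x n \<in> {x. c \<le> smooth r x}) \<and> x \<longlonglongrightarrow> l"
  define k where "k = c * (2 * r) ^ DIM('a)"
  have iff: "c \<le> smooth r z \<longleftrightarrow> k \<le> measure M (cbox (z - r *\<^sub>R One) (z + r *\<^sub>R One))" for z
    using r by (simp add: smooth_def k_def field_simps)
  define A where "A m = cbox (l - (r + 1 / real (Suc m)) *\<^sub>R One) (l + (r + 1 / real (Suc m)) *\<^sub>R One)" for m
  have "k \<le> measure M (A m)" for m
  proof -
    have "\<forall>\<^sub>F n in sequentially. dist (x n) l < 1 / real (Suc m)"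
      using h by (intro tendstoD) auto
    then obtain n where n: "dist (x n) l < 1 / real (Suc m)" by (auto simp: eventually_sequentially)
    have "cbox (x n - r *\<^sub>R One) (x n + r *\<^sub>R One) \<subseteq> A m"
    proof
      fix z assume z: "z \<in> cbox (x n - r *\<^sub>R One) (x n + r *\<^sub>R One)"
      show "z \<in> A m"
        unfolding A_def mem_cbox_centered
      proof
        fix i :: 'a assume i: "i \<in> Basis"
        have "\<bar>x n \<bullet> i - l \<bullet> i\<bar> < 1 / real (Suc m)"
          using Basis_le_norm[OF i, of "x n - l"] n by (simp add: dist_norm inner_diff_left)
        moreover have "\<bar>z \<bullet> i - x n \<bullet> i\<bar> \<le> r" using z i unfolding mem_cbox_centered by blast
        ultimately show "\<bar>z \<bullet> i - l \<bullet> i\<bar> \<le> r + 1 / real (Suc m)" by linarith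
      qed
    qed
    then have "measure M (cbox (x n - r *\<^sub>R One) (x n + r *\<^sub>R One)) \<le> measure M (A m)"
      by (intro finite_measure_mono) (auto simp: A_def)
    then show ?thesis using h iff[of "x n"] by auto
  qed
  moreover have "(\<lambda>m. measure M (A m)) \<longlonglongrightarrow> measure M (\<Inter>m. A m)"
  proof (rule finite_Lim_measure_decseq)
    show "decseq A"
    proof (rule decseq_SucI)
      fix m
      have "1 / real (Suc (Suc m)) \<le> 1 / real (Suc m)" by (simp add: frac_le)
      then show "A (Suc m) \<subseteq> A m"
        unfolding A_def subset_iff mem_cbox_centered by (meson add_left_mono order_trans)
    qed
  qed (auto simp: A_def)
  ultimately have "k \<le> measure M (\<Inter>m. A m)" by (intro LIMSEQ_le_const) auto
  also have "\<dots> \<le> measure M (cbox (l - r *\<^sub>R One) (l + r *\<^sub>R One))"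
  proof (rule finite_measure_mono)
    show "(\<Inter>m. A m) \<subseteq> cbox (l - r *\<^sub>R One) (l + r *\<^sub>R One)"
    proof
      fix z assume z: "z \<in> (\<Inter>m. A m)"
      show "z \<in> cbox (l - r *\<^sub>R One) (l + r *\<^sub>R One)"
        unfolding mem_cbox_centered
      proof
        fix i :: 'a assume i: "i \<in> Basis"
        show "\<bar>z \<bullet> i - l \<bullet> i\<bar> \<le> r"
        proof (rule field_le_epsilon)
          fix e :: real assume "0 < e"
          then obtain m where m: "inverse (real (Suc m)) < e" using reals_Archimedean by blast
          have "z \<in> A m" using z by auto
          then have "\<bar>z \<bullet> i - l \<bullet> i\<bar> \<le> r + 1 / real (Suc m)"
            using i unfolding A_def mem_cbox_centered by blast
          then show "\<bar>z \<bullet> i - l \<bullet> i\<bar> \<le> r + e" using m by (simp add: inverse_eq_divide)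
        qed
      qed
    qed
  qed simp
  finally show "l \<in> {x. c \<le> smooth r x}" by (simp add: iff)
qed

text \<open>Fubini and the substitution \<open>x = y + w\<close> exhibit the smoothed measure as the
  law of a point of \<open>M\<close> plus an independent uniform point of the cube. The comparisons
  with \<open>M\<close> are read off this formula.\<close>

lemma emeasure_smooth:
  assumes r: "0 < r" and E: "E \<in> sets borel"
  shows "emeasure (density lborel (\<lambda>x. ennreal (smooth r x))) E = ennreal (1 / (2 * r) ^ DIM('a)) *
    (\<integral>\<^sup>+y. (\<integral>\<^sup>+w. indicator (cbox (- r *\<^sub>R One) (r *\<^sub>R One)) w * indicator E (y + w) \<partial>lborel) \<partial>M)"
proof -
  let ?k = "ennreal (1 / (2 * r) ^ DIM('a))"
  let ?Q = "cbox (- r *\<^sub>R One) (r *\<^sub>R One) :: 'a set"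
  interpret P: pair_sigma_finite M "lborel :: 'a measure" ..
  have [measurable]: "smooth r \<in> borel_measurable borel" by (rule borel_measurable_usc[OF usc_smooth[OF r]])
  note E [measurable]
  have mem: "y \<in> cbox (x - r *\<^sub>R One) (x + r *\<^sub>R One) \<longleftrightarrow> x - y \<in> ?Q" for x y :: 'a
    unfolding mem_cbox_centered mem_cbox_One by (simp add: inner_diff_left abs_minus_commute)
  have "emeasure (density lborel (\<lambda>x. ennreal (smooth r x))) E = (\<integral>\<^sup>+x. ennreal (smooth r x) * indicator E x \<partial>lborel)"
    by (rule emeasure_density) auto
  also have "\<dots> = (\<integral>\<^sup>+x. ?k * (\<integral>\<^sup>+y. indicator ?Q (x - y) * indicator E x \<partial>M) \<partial>lborel)"
  proof (rule nn_integral_cong)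
    fix x :: 'a
    have "ennreal (smooth r x) = ?k * emeasure M (cbox (x - r *\<^sub>R One) (x + r *\<^sub>R One))"
      using r unfolding smooth_def emeasure_eq_measure by (intro ennreal_mult) auto
    also have "emeasure M (cbox (x - r *\<^sub>R One) (x + r *\<^sub>R One)) = (\<integral>\<^sup>+y. indicator (cbox (x - r *\<^sub>R One) (x + r *\<^sub>R One)) y \<partial>M)"
      by (rule nn_integral_indicator[symmetric]) simp
    also have "\<dots> = (\<integral>\<^sup>+y. indicator ?Q (x - y) \<partial>M)"
      by (intro nn_integral_cong) (simp only: indicator_def mem)
    finally show "ennreal (smooth r x) * indicator E x = ?k * (\<integral>\<^sup>+y. indicator ?Q (x - y) * indicator E x \<partial>M)"
      by (subst nn_integral_multc) (auto simp: mult.assoc)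
  qed
  also have "\<dots> = ?k * (\<integral>\<^sup>+x. (\<integral>\<^sup>+y. indicator ?Q (x - y) * indicator E x \<partial>M) \<partial>lborel)"
    by (rule nn_integral_cmult) measurable
  also have "(\<integral>\<^sup>+x. (\<integral>\<^sup>+y. indicator ?Q (x - y) * indicator E x \<partial>M) \<partial>lborel) =
      (\<integral>\<^sup>+y. (\<integral>\<^sup>+x. indicator ?Q (x - y) * indicator E x \<partial>lborel) \<partial>M)"
    by (rule P.Fubini') measurable
  also have "\<dots> = (\<integral>\<^sup>+y. (\<integral>\<^sup>+w. indicator ?Q w * indicator E (y + w) \<partial>lborel) \<partial>M)"
  proof (rule nn_integral_cong)
    fix y :: 'a
    show "(\<integral>\<^sup>+x. indicator ?Q (x - y) * indicator E x \<partial>lborel) = (\<integral>\<^sup>+w. indicator ?Q w * indicator E (y + w) \<partial>lborel)"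
      by (subst nn_integral_lborel_affine[of _ 1 y]) auto
  qed
  finally show ?thesis .
qed

lemma prob_space_smooth:
  assumes r: "0 < r"
  shows "prob_space (density lborel (\<lambda>x. ennreal (smooth r x)))"
proof
  have "(\<integral>\<^sup>+w. indicator (cbox (- r *\<^sub>R One) (r *\<^sub>R One)) w * indicator UNIV (y + w) \<partial>lborel) = ennreal ((2 * r) ^ DIM('a))" for y :: 'a
    using emeasure_lborel_cbox_One[of r, where 'a='a] r by (simp only: indicator_UNIV mult_1_right nn_integral_indicator sets_lborel borel_closed closed_cbox less_imp_le)
  then have "emeasure (density lborel (\<lambda>x. ennreal (smooth r x))) UNIV =
      ennreal (1 / (2 * r) ^ DIM('a)) * (\<integral>\<^sup>+y. ennreal ((2 * r) ^ DIM('a)) \<partial>M)"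
    by (simp only: emeasure_smooth[OF r, of UNIV] sets.top[of borel, unfolded space_borel])
  also have "\<dots> = ennreal (1 / (2 * r) ^ DIM('a)) * ennreal ((2 * r) ^ DIM('a))"
    using emeasure_space_1 by (simp only: nn_integral_const mult_1_right)
  also have "\<dots> = 1" using r by (simp add: ennreal_mult[symmetric])
  finally show "emeasure (density lborel (\<lambda>x. ennreal (smooth r x))) (space (density lborel (\<lambda>x. ennreal (smooth r x)))) = 1"
    by (simp only: space_density space_lborel space_borel)
qed

text \<open>For half-spaces, exchanging the integrals shows that the smoothed mass at
  \<open>c\<close> is the average of \<open>G (c - u \<bullet> w)\<close> over the cube, so
  \<open>log_concave_box_average\<close> gives its log-concavity in \<open>c\<close>.\<close>

lemma log_concave_density_smooth:
  assumes r: "0 < r"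
  shows "log_concave_density (smooth r)"
proof (rule log_concave_density.intro)
  show "log_concave_fun (smooth r)" by (rule log_concave_smooth[OF r])
  show "closed {x. c \<le> smooth r x}" for c by (rule usc_smooth[OF r])
  show "prob_space (density lborel (\<lambda>x. ennreal (smooth r x)))" by (rule prob_space_smooth[OF r])
  then interpret N: prob_space "density lborel (\<lambda>x. ennreal (smooth r x))" .
  interpret P: pair_sigma_finite M "lborel :: 'a measure" ..
  fix u :: 'a
  let ?Q = "cbox (- r *\<^sub>R One) (r *\<^sub>R One) :: 'a set"
  define G where "G c = measure M {y. u \<bullet> y \<le> c}" for c
  have mono: "mono G" unfolding G_def mono_def by (intro allI impI finite_measure_mono) auto
  have lc: "log_concave_fun G" using log_concave_halfspace[of u] by (simp add: G_def[abs_def])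
  obtain Q where Q: "log_concave_fun Q" and
    IQ: "\<And>c. (\<integral>\<^sup>+w. ennreal (G (c - u \<bullet> w)) * indicator ?Q w \<partial>lborel) = ennreal (Q c)"
    using log_concave_box_average[OF mono lc less_imp_le[OF r]] by blast
  have "measure (density lborel (\<lambda>x. ennreal (smooth r x))) {y. u \<bullet> y \<le> c} = 1 / (2 * r) ^ DIM('a) * Q c" for c
  proof -
    have "(\<integral>\<^sup>+y. (\<integral>\<^sup>+w. indicator ?Q w * indicator {y. u \<bullet> y \<le> c} (y + w) \<partial>lborel) \<partial>M) =
      (\<integral>\<^sup>+w. (\<integral>\<^sup>+y. indicator ?Q w * indicator {y. u \<bullet> y \<le> c} (y + w) \<partial>M) \<partial>lborel)"
      by (rule P.Fubini'[symmetric]) measurable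
    also have "\<dots> = (\<integral>\<^sup>+w. ennreal (G (c - u \<bullet> w)) * indicator ?Q w \<partial>lborel)"
    proof (rule nn_integral_cong)
      fix w :: 'a
      have "(\<integral>\<^sup>+y. indicator ?Q w * indicator {y. u \<bullet> y \<le> c} (y + w) \<partial>M) =
        (\<integral>\<^sup>+y. indicator ?Q w * indicator {y. u \<bullet> y \<le> c - u \<bullet> w} y \<partial>M)"
        by (intro nn_integral_cong) (auto simp: indicator_def inner_add_right)
      also have "\<dots> = indicator ?Q w * emeasure M {y. u \<bullet> y \<le> c - u \<bullet> w}"
        by (subst nn_integral_cmult_indicator) auto
      finally show "(\<integral>\<^sup>+y. indicator ?Q w * indicator {y. u \<bullet> y \<le> c} (y + w) \<partial>M) = ennreal (G (c - u \<bullet> w)) * indicator ?Q w"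
        by (simp add: G_def emeasure_eq_measure mult.commute)
    qed
    finally have "emeasure (density lborel (\<lambda>x. ennreal (smooth r x))) {y. u \<bullet> y \<le> c} = ennreal (1 / (2 * r) ^ DIM('a)) * ennreal (Q c)"
      using emeasure_smooth[OF r, of "{y. u \<bullet> y \<le> c}"] IQ by simp
    also have "\<dots> = ennreal (1 / (2 * r) ^ DIM('a) * Q c)"
      using r log_concave_fun_nonneg[OF Q] by (intro ennreal_mult[symmetric]) auto
    finally show ?thesis
      using r log_concave_fun_nonneg[OF Q] unfolding N.emeasure_eq_measure by (subst (asm) ennreal_inj) auto
  qed
  then show "log_concave_fun (\<lambda>c. measure (density lborel (\<lambda>x. ennreal (smooth r x))) {y. u \<bullet> y \<le> c})"
    using log_concave_fun_scale[OF Q, of "1 / (2 * r) ^ DIM('a)"] r by simp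
qed

end

section \<open>Floating bodies and their comparison under smoothing\<close>

context log_concave_measure
begin

text \<open>The margin \<open>1 / (m + 1)\<close> absorbs the displacement caused by smoothing at a small scale.\<close>

definition shallow :: "real \<Rightarrow> nat \<Rightarrow> 'a set" where
  "shallow e m = (\<Union>(u, b)\<in>{(u, b). norm u = 1 \<and> measure M {y. u \<bullet> y \<le> b + 1 / real (Suc m)} < e}. {x. u \<bullet> x < b})"

lemma open_shallow: "open (shallow e m)"
  unfolding shallow_def by (intro open_UN ballI) (auto intro: open_halfspace_lt)

lemma incseq_shallow: "incseq (shallow e)"
proof (rule incseq_SucI)
  fix m
  have "1 / real (Suc (Suc m)) \<le> 1 / real (Suc m)" by (simp add: frac_le)
  then have "measure M {y. u \<bullet> y \<le> b + 1 / real (Suc (Suc m))} \<le> measure M {y. u \<bullet> y \<le> b + 1 / real (Suc m)}" for u b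
    by (intro finite_measure_mono) auto
  then show "shallow e m \<subseteq> shallow e (Suc m)"
    unfolding shallow_def by (fastforce intro: le_less_trans)
qed

text \<open>A point of depth below \<open>exp (- s)\<close> lies in some half-space of mass below
  \<open>exp (- s)\<close>; after normalising its normal, right-continuity of the mass lets the
  boundary move outwards a little. The complement thus becomes an increasing union of open sets,
  which settles measurability and allows a limit in \<open>m\<close>.\<close>

lemma floating_body_eq: "floating_body M s = - (\<Union>m. shallow (exp (- s)) m)"
proof -
  have bdd: "bdd_below {measure M H | H. closed_halfspace H \<and> x \<in> H}" for x
    by (rule bdd_belowI[of _ 0]) auto
  have "x \<notin> floating_body M s" if x: "x \<in> shallow (exp (- s)) m" for x m
  proof -
    obtain u b where u: "norm u = 1" "measure M {y. u \<bullet> y \<le> b + 1 / real (Suc m)} < exp (- s)" "u \<bullet> x < b"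
      using x by (auto simp: shallow_def)
    have "halfspace_depth M x \<le> measure M {y. u \<bullet> y \<le> b}"
      unfolding halfspace_depth_def
      by (rule cInf_lower[OF _ bdd]) (use u in \<open>auto simp: closed_halfspace_def intro!: exI[of _ "{y. u \<bullet> y \<le> b}"] exI[of _ u] exI[of _ b]\<close>)
    also have "\<dots> \<le> measure M {y. u \<bullet> y \<le> b + 1 / real (Suc m)}"
      by (intro finite_measure_mono) (auto simp: add_increasing2)
    finally show ?thesis using u by (simp add: floating_body_def)
  qed
  moreover have "\<exists>m. x \<in> shallow (exp (- s)) m" if x: "x \<notin> floating_body M s" for x
  proof -
    obtain i :: 'a where i: "i \<in> Basis" using nonempty_Basis by blast
    have "closed_halfspace {y. i \<bullet> y \<le> i \<bullet> x}"
      unfolding closed_halfspace_def using i nonzero_Basis by blast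
    then have "{measure M H | H. closed_halfspace H \<and> x \<in> H} \<noteq> {}" by blast
    then obtain H where H: "closed_halfspace H" "x \<in> H" "measure M H < exp (- s)"
      using x cInf_less_iff[OF _ bdd, of x "exp (- s)"]
      unfolding floating_body_def halfspace_depth_def by auto
    then obtain u0 b0 where u0: "u0 \<noteq> 0" "H = {x. u0 \<bullet> x \<le> b0}" by (auto simp: closed_halfspace_def)
    define u where "u = (1 / norm u0) *\<^sub>R u0"
    define b where "b = b0 / norm u0"
    have u: "norm u = 1" "H = {x. u \<bullet> x \<le> b}" using u0 by (auto simp: u_def b_def divide_right_mono divide_le_cancel)
    have "closed {c. exp (- s) \<le> measure M {y \<in> space M. u \<bullet> y \<le> c}}"
      by (rule closed_superlevel_cdf) simp
    then have "open {c. measure M {y. u \<bullet> y \<le> c} < exp (- s)}"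
      by (simp add: closed_def Collect_neg_eq[symmetric] not_le)
    moreover have "b \<in> {c. measure M {y. u \<bullet> y \<le> c} < exp (- s)}" using H u by simp
    ultimately obtain e where e: "0 < e" "\<And>c. dist c b < e \<Longrightarrow> measure M {y. u \<bullet> y \<le> c} < exp (- s)"
      unfolding open_dist by blast
    \<comment> \<open>One half of \<open>e\<close> makes \<open>u \<bullet> x\<close> strictly
      smaller than the new bound, the other half is the margin built into
      \<open>shallow\<close>.\<close>
    obtain m where m: "inverse (real (Suc m)) < e / 2" using reals_Archimedean[of "e / 2"] e by auto
    then have "measure M {y. u \<bullet> y \<le> (b + 1 / real (Suc m)) + 1 / real (Suc m)} < exp (- s)"
      by (intro e) (simp add: dist_norm inverse_eq_divide)
    moreover have "u \<bullet> x < b + 1 / real (Suc m)" using H(2) u(2) by (auto intro: le_less_trans)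
    ultimately show ?thesis
      using u(1) unfolding shallow_def
      by (intro exI[of _ m] UN_I[of "(u, b + 1 / real (Suc m))"]) simp_all
  qed
  ultimately show ?thesis by blast
qed

text \<open>Smoothing moves a point by at most \<open>n r\<close> in norm, hence by at most that in
  a unit direction.\<close>

lemma measure_smooth_halfspace_le:
  fixes r :: real
  assumes r: "0 < r" and u: "norm u = 1"
  shows "measure (density lborel (\<lambda>x. ennreal (smooth r x))) {y. u \<bullet> y \<le> c} \<le> measure M {y. u \<bullet> y \<le> c + DIM('a) * r}"
    (is "?L \<le> _")
proof -
  interpret N: prob_space "density lborel (\<lambda>x. ennreal (smooth r x))" by (rule prob_space_smooth[OF r])
  let ?Q = "cbox (- r *\<^sub>R One) (r *\<^sub>R One) :: 'a set"
  let ?k = "ennreal (1 / (2 * r) ^ DIM('a))"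
  have "emeasure (density lborel (\<lambda>x. ennreal (smooth r x))) {y. u \<bullet> y \<le> c} = ?k *
    (\<integral>\<^sup>+y. (\<integral>\<^sup>+w. indicator ?Q w * indicator {y. u \<bullet> y \<le> c} (y + w) \<partial>lborel) \<partial>M)"
    by (rule emeasure_smooth[OF r]) simp
  also have "\<dots> \<le> ?k * (\<integral>\<^sup>+y. (\<integral>\<^sup>+w. indicator {y. u \<bullet> y \<le> c + DIM('a) * r} y * indicator ?Q w \<partial>lborel) \<partial>M)"
  proof (intro mult_left_mono nn_integral_mono)
    fix y w :: 'a
    have "u \<bullet> y \<le> c + DIM('a) * r" if w: "w \<in> ?Q" "u \<bullet> (y + w) \<le> c"
    proof -
      have "- (u \<bullet> w) \<le> norm u * norm w" using norm_cauchy_schwarz[of u "- w"] by simp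
      also have "\<dots> \<le> DIM('a) * r" using norm_mem_cbox_One[OF w(1)] u by simp
      finally show ?thesis using w(2) by (simp add: inner_add_right)
    qed
    then show "indicator ?Q w * indicator {y. u \<bullet> y \<le> c} (y + w) \<le> (indicator {y. u \<bullet> y \<le> c + DIM('a) * r} y * indicator ?Q w :: ennreal)"
      by (simp add: indicator_def)
  qed simp
  also have "(\<lambda>y. \<integral>\<^sup>+w. indicator {y. u \<bullet> y \<le> c + DIM('a) * r} y * indicator ?Q w \<partial>lborel) =
      (\<lambda>y. indicator {y. u \<bullet> y \<le> c + DIM('a) * r} y * ennreal ((2 * r) ^ DIM('a)))"
    using emeasure_lborel_cbox_One[of r, where 'a='a] r
    by (intro ext) (simp only: nn_integral_cmult_indicator sets_lborel borel_closed closed_cbox less_imp_le)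
  also have "(\<integral>\<^sup>+y. indicator {y. u \<bullet> y \<le> c + DIM('a) * r} y * ennreal ((2 * r) ^ DIM('a)) \<partial>M) =
      emeasure M {y. u \<bullet> y \<le> c + DIM('a) * r} * ennreal ((2 * r) ^ DIM('a))"
    by (subst nn_integral_multc) auto
  also have "?k * \<dots> = (?k * ennreal ((2 * r) ^ DIM('a))) * emeasure M {y. u \<bullet> y \<le> c + DIM('a) * r}"
    by (simp only: mult_ac)
  also have "?k * ennreal ((2 * r) ^ DIM('a)) = 1" using r by (simp add: ennreal_mult[symmetric])
  finally show ?thesis by (simp add: emeasure_eq_measure N.emeasure_eq_measure)
qed

text \<open>A displaced point can land in \<open>S\<close> only if it started outside
  \<open>G\<close>.\<close>

lemma measure_smooth_disjoint_le:
  assumes r: "0 < r" and S: "S \<in> sets borel" and G: "G \<in> sets borel"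
    and disj: "\<And>y w. y \<in> G \<Longrightarrow> w \<in> cbox (- r *\<^sub>R One) (r *\<^sub>R One) \<Longrightarrow> y + w \<notin> S"
  shows "measure (density lborel (\<lambda>x. ennreal (smooth r x))) S \<le> 1 - measure M G"
proof -
  interpret N: prob_space "density lborel (\<lambda>x. ennreal (smooth r x))" by (rule prob_space_smooth[OF r])
  let ?Q = "cbox (- r *\<^sub>R One) (r *\<^sub>R One) :: 'a set"
  let ?k = "ennreal (1 / (2 * r) ^ DIM('a))"
  have "emeasure (density lborel (\<lambda>x. ennreal (smooth r x))) S = ?k *
    (\<integral>\<^sup>+y. (\<integral>\<^sup>+w. indicator ?Q w * indicator S (y + w) \<partial>lborel) \<partial>M)"
    by (rule emeasure_smooth[OF r S])
  also have "\<dots> \<le> ?k * (\<integral>\<^sup>+y. (\<integral>\<^sup>+w. indicator (- G) y * indicator ?Q w \<partial>lborel) \<partial>M)"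
    using disj by (intro mult_left_mono nn_integral_mono) (auto simp: indicator_def)
  also have "(\<lambda>y. \<integral>\<^sup>+w. indicator (- G) y * indicator ?Q w \<partial>lborel) =
      (\<lambda>y. indicator (- G) y * ennreal ((2 * r) ^ DIM('a)))"
    using emeasure_lborel_cbox_One[of r, where 'a='a] r
    by (intro ext) (simp only: nn_integral_cmult_indicator sets_lborel borel_closed closed_cbox less_imp_le)
  also have "(\<integral>\<^sup>+y. indicator (- G) y * ennreal ((2 * r) ^ DIM('a)) \<partial>M) =
      emeasure M (- G) * ennreal ((2 * r) ^ DIM('a))"
    using G by (subst nn_integral_multc) auto
  also have "?k * \<dots> = (?k * ennreal ((2 * r) ^ DIM('a))) * emeasure M (- G)"
    by (simp only: mult_ac)
  also have "?k * ennreal ((2 * r) ^ DIM('a)) = 1" using r by (simp add: ennreal_mult[symmetric])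
  finally have "measure (density lborel (\<lambda>x. ennreal (smooth r x))) S \<le> measure M (- G)"
    by (simp add: emeasure_eq_measure N.emeasure_eq_measure)
  also have "measure M (- G) = 1 - measure M G" using prob_compl[of G] G by (simp add: Compl_eq_Diff_UNIV)
  finally show ?thesis .
qed

text \<open>For each \<open>m\<close> a deep set \<open>S\<close> of the measure smoothed at a scale
  depending on \<open>m\<close> cannot be reached from \<open>shallow (exp (- s)) m\<close>, which
  bounds the mass of that set. The bound is the same for all \<open>m\<close>, so the limit is taken
  in the sets under \<open>M\<close> and not in the smoothed measures.\<close>

lemma measure_floating_body_ge:
  assumes a: "0 < a" "a < 1 - 3 ^ DIM('a) * exp (- (2 * t / 3))" and t: "0 \<le> t"
    and d: "0 < d" "d < 1"
    and s: "exp (- s) \<le> d ^ DIM('a) * exp (- ((1 - d) * t)) * exp (- (1 / a))"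
  shows "(1 - d) ^ DIM('a) * a \<le> measure M (floating_body M s)"
proof -
  have bound: "measure M (shallow (exp (- s)) m) \<le> 1 - (1 - d) ^ DIM('a) * a" for m
  proof -
    \<comment> \<open>The displacement \<open>n r\<close> is paid twice, once from \<open>y\<close>
      to \<open>y + w\<close> and once from the smoothed half-space to that of \<open>M\<close>;
      together they use up the margin \<open>1 / (m + 1)\<close>.\<close>
    define r where "r = 1 / (2 * real (Suc m) * DIM('a))"
    have "0 < 2 * real (Suc m) * DIM('a)" using DIM_positive[where 'a='a] by (intro mult_pos_pos) auto
    then have r: "0 < r" "DIM('a) * r + DIM('a) * r = 1 / real (Suc m)"
      by (simp_all only: r_def mult_2[symmetric] zero_less_divide_1_iff) (simp add: field_simps)
    interpret D: log_concave_density "smooth r" by (rule log_concave_density_smooth[OF r(1)])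
    obtain S where S: "S \<in> sets borel" "(1 - d) ^ DIM('a) * a \<le> measure D.N S"
      and deep: "\<And>x u b. x \<in> S \<Longrightarrow> u \<bullet> x \<le> b \<Longrightarrow>
        d ^ DIM('a) * exp (- ((1 - d) * t)) * exp (- (1 / a)) \<le> measure D.N {w. u \<bullet> w \<le> b}"
      using D.deep_set[OF a t d] by blast
    have "measure D.N S \<le> 1 - measure M (shallow (exp (- s)) m)"
    proof (rule measure_smooth_disjoint_le[OF r(1) S(1)])
      show "shallow (exp (- s)) m \<in> sets borel" using open_shallow by (rule borel_open)
    next
      fix y w :: 'a assume "y \<in> shallow (exp (- s)) m" and w: "w \<in> cbox (- r *\<^sub>R One) (r *\<^sub>R One)"
      then obtain u b where u: "norm u = 1" "measure M {y. u \<bullet> y \<le> b + 1 / real (Suc m)} < exp (- s)" "u \<bullet> y < b"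
        by (auto simp: shallow_def)
      show "y + w \<notin> S"
      proof
        assume yw: "y + w \<in> S"
        have "u \<bullet> w \<le> norm u * norm w" by (rule norm_cauchy_schwarz)
        also have "\<dots> \<le> DIM('a) * r" using norm_mem_cbox_One[OF w] u by simp
        finally have "u \<bullet> (y + w) \<le> b + DIM('a) * r" using u(3) by (simp add: inner_add_right)
        then have "exp (- s) \<le> measure D.N {z. u \<bullet> z \<le> b + DIM('a) * r}"
          using deep[OF yw] s by (meson order_trans)
        also have "\<dots> \<le> measure M {z. u \<bullet> z \<le> (b + DIM('a) * r) + DIM('a) * r}"
          by (rule measure_smooth_halfspace_le[OF r(1) u(1)])
        also have "(b + DIM('a) * r) + DIM('a) * r = b + 1 / real (Suc m)" using r(2) by simp
        finally show False using u(2) by simp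
      qed
    qed
    then show ?thesis using S(2) by linarith
  qed
  have "(\<lambda>m. measure M (shallow (exp (- s)) m)) \<longlonglongrightarrow> measure M (\<Union>m. shallow (exp (- s)) m)"
    by (rule finite_Lim_measure_incseq) (auto simp: incseq_shallow open_shallow)
  then have "measure M (\<Union>m. shallow (exp (- s)) m) \<le> 1 - (1 - d) ^ DIM('a) * a"
    by (rule LIMSEQ_le_const2) (use bound in blast)
  moreover have "(\<Union>m. shallow (exp (- s)) m) \<in> sets borel"
    by (intro borel_open open_UN ballI open_shallow)
  then have "measure M (floating_body M s) = 1 - measure M (\<Union>m. shallow (exp (- s)) m)"
    unfolding floating_body_eq using prob_compl[of "\<Union>m. shallow (exp (- s)) m"] by (simp add: Compl_eq_Diff_UNIV)
  ultimately show ?thesis by linarith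
qed

end

section \<open>Choice of the parameters\<close>

lemma one_minus_exp_le: "1 - exp (- v) \<le> (v :: real)"
  using exp_ge_add_one_self[of "- v"] by simp

text \<open>With \<open>x = 1 - y\<close> the right side is \<open>1 / x - x\<close>. The difference
  of the two sides vanishes at 0 and has derivative
  \<open>z\<^sup>2 / (1 - z)\<^sup>2\<close>.\<close>

lemma minus_ln_one_minus_le:
  fixes y :: real
  assumes "0 \<le> y" "y < 1"
  shows "- 2 * ln (1 - y) \<le> y * (2 - y) / (1 - y)"
proof -
  define h where "h z = z * (2 - z) / (1 - z) + 2 * ln (1 - z)" for z :: real
  have "h 0 \<le> h y"
  proof (rule DERIV_nonneg_imp_nondecreasing[OF assms(1)])
    fix z assume z: "0 \<le> z" "z \<le> y"
    have "DERIV h z :> ((2 - 2 * z) * (1 - z) + z * (2 - z)) / (1 - z)\<^sup>2 - 2 / (1 - z)"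
      unfolding h_def using z assms
      by (auto intro!: derivative_eq_intros simp: power2_eq_square field_simps)
    moreover have "((2 - 2 * z) * (1 - z) + z * (2 - z)) / (1 - z)\<^sup>2 - 2 / (1 - z) = z\<^sup>2 / (1 - z)\<^sup>2"
      using z assms by (simp add: power2_eq_square divide_simps) (simp add: algebra_simps)
    ultimately show "\<exists>D. DERIV h z :> D \<and> D \<ge> 0" by auto
  qed
  then show ?thesis by (simp add: h_def)
qed

text \<open>The parameters are those of \<open>measure_floating_body_ge\<close>, with its depth condition in logarithmic
  form. They are chosen in terms of \<open>v = (s - n\<^sup>2 ln n) / (8 n)\<close>, the negated logarithm of the bound
  to be shown. A choice that is good for large \<open>v\<close> fails for small \<open>v\<close> in dimensions 2 and 3.\<close>

definition admissible :: "nat \<Rightarrow> real \<Rightarrow> real \<Rightarrow> real \<Rightarrow> real \<Rightarrow> bool" where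
  "admissible n s d t a \<longleftrightarrow> 0 < d \<and> d < 1 \<and> 0 \<le> t \<and> 0 < a \<and> a < 1 - 3 ^ n * exp (- (2 * t / 3)) \<and>
    - real n * ln d + (1 - d) * t + 1 / a \<le> s"

text \<open>Below, 9 is compared with 8; above, \<open>ln 3 = ln 2 - ln (2/3)\<close> is combined
  with \<open>minus_ln_one_minus_le\<close> at 1/3.\<close>

lemma ln_3_bounds: "ln (3::real) \<ge> 19/18" "ln (3::real) \<le> 10/9"
proof -
  have "ln (9::real) = 2 * ln 3" "ln (8::real) = 3 * ln 2"
    using ln_realpow[of 3 2] ln_realpow[of 2 3] by simp_all
  moreover have "ln (8/9::real) = ln 8 - ln 9" by (rule ln_divide_pos) auto
  moreover have "ln (8/9::real) \<le> 8/9 - 1" by (rule ln_le_minus_one) simp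
  ultimately show "ln (3::real) \<ge> 19/18" using ln2_ge_two_thirds by linarith
  have "ln (2/3::real) = ln 2 - ln 3" by (rule ln_divide_pos) auto
  then show "ln (3::real) \<le> 10/9"
    using minus_ln_one_minus_le[of "1/3"] ln2_le_25_over_36 by simp
qed

text \<open>\<open>145/128 = 1 + 1/8 + 1/128\<close> is the quadratic Taylor polynomial of
  \<open>exp\<close> at 1/8.\<close>

lemma exp_ge_rational_power: "(145/128) ^ (8 * k) \<le> exp (real k)"
proof -
  have "145/128 \<le> exp (1/8::real)"
    using exp_lower_Taylor_quadratic[of "1/8"] by (simp add: power2_eq_square)
  then have "(145/128) ^ (8 * k) \<le> exp (1/8::real) ^ (8 * k)" by (rule power_mono) simp
  also have "\<dots> = exp (real k)" by (simp add: exp_of_nat_mult[symmetric])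
  finally show ?thesis .
qed

text \<open>The permitted loss \<open>exp (- v)\<close> is split evenly between the contraction,
  through Bernoulli's inequality, and the discarded mass \<open>1 - a\<close>. Depth then costs
  \<open>(n + 3/2) v\<close> plus constants; subtracting this from \<open>8 n v\<close> leaves the
  hypothesis \<open>le\<close>.\<close>

lemma admissible_generic:
  fixes v :: real
  assumes n: "2 \<le> n" and v: "0 \<le> v"
    and le: "real n * ln (2 * real n) + 3/2 * (ln 2 + real n * ln 3) + 21/10
      \<le> real n ^ 2 * ln (real n) + (7 * real n - 3/2) * v"
  shows "\<exists>d t a. admissible n (real n ^ 2 * ln (real n) + 8 * real n * v) d t a \<and> 1 - exp (- v) \<le> (1 - d) ^ n * a"
proof -
  define d where "d = exp (- v) / (2 * real n)"
  \<comment> \<open>Without the 1/10 the tail bound would equal \<open>1 - a\<close>; the extra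
    amount makes the inequality strict. Together with \<open>1 / a \<le> 2\<close> it gives the
    21/10.\<close>
  define t where "t = 3/2 * (v + ln 2 + real n * ln 3) + 1/10"
  define a where "a = 1 - exp (- v) / 2"
  have ev: "0 < exp (- v)" "exp (- v) \<le> 1" using v by auto
  have d: "0 < d" "real n * d = exp (- v) / 2" using n by (auto simp: d_def)
  have d1: "d \<le> 1/4"
  proof -
    have "2 * exp (- v) \<le> real n" using ev n by linarith
    then show ?thesis unfolding d_def using n by (simp add: divide_simps)
  qed
  have t: "0 \<le> t" unfolding t_def using v by (intro add_nonneg_nonneg mult_nonneg_nonneg) auto
  have a: "1/2 \<le> a" using ev by (simp add: a_def)
  have "3 ^ n * exp (- (2 * t / 3)) = exp (- v) / 2 * exp (- (1/15))"
  proof -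
    have "- (2 * t / 3) = - v + - ln 2 + - (real n * ln 3) + - (1/15)" by (simp add: t_def field_simps)
    then have "exp (- (2 * t / 3)) = exp (- v) * exp (- ln 2) * exp (- (real n * ln 3)) * exp (- (1/15))"
      by (simp only: exp_add)
    moreover have "exp (- (real n * ln 3)) = 1 / 3 ^ n"
      by (simp add: exp_minus exp_of_nat_mult inverse_eq_divide)
    moreover have "exp (- ln 2) = (1/2::real)" by (simp add: exp_minus)
    ultimately show ?thesis by simp
  qed
  also have "\<dots> < exp (- v) / 2 * 1" by (intro mult_strict_left_mono) auto
  finally have a2: "a < 1 - 3 ^ n * exp (- (2 * t / 3))" by (simp add: a_def)
  have lnd: "- ln d = v + ln (2 * real n)"
    unfolding d_def using n by (simp add: ln_div)
  have "- real n * ln d = real n * v + real n * ln (2 * real n)"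
    using lnd by (metis minus_mult_commute distrib_left)
  moreover have "(1 - d) * t \<le> 1 * t" using d t by (intro mult_right_mono) auto
  moreover have "1 / a \<le> 2" using a by (simp add: divide_simps)
  ultimately have "- real n * ln d + (1 - d) * t + 1 / a \<le> real n * v + real n * ln (2 * real n) + t + 2" by linarith
  also have "\<dots> = real n * ln (2 * real n) + 3/2 * (ln 2 + real n * ln 3) + 21/10 + (real n + 3/2) * v"
    by (simp add: t_def algebra_simps)
  also have "\<dots> \<le> real n ^ 2 * ln (real n) + (7 * real n - 3/2) * v + (real n + 3/2) * v"
    using le by simp
  also have "\<dots> = real n ^ 2 * ln (real n) + 8 * real n * v" by (simp add: algebra_simps)
  finally have "admissible n (real n ^ 2 * ln (real n) + 8 * real n * v) d t a"
    unfolding admissible_def using d d1 t a a2 by auto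
  moreover have "1 - exp (- v) \<le> (1 - d) ^ n * a"
  proof -
    have "1 - exp (- v) / 2 \<le> (1 - d) ^ n"
      using Bernoulli_inequality[of "- d" n] d d1 by simp
    then have "(1 - exp (- v) / 2) * (1 - exp (- v) / 2) \<le> (1 - d) ^ n * a"
      using ev(2) unfolding a_def by (intro mult_right_mono) (assumption, linarith)
    moreover have "(1 - exp (- v) / 2) * (1 - exp (- v) / 2) = 1 - exp (- v) + (exp (- v) / 2)\<^sup>2"
      by (simp add: power2_eq_square field_simps)
    ultimately show ?thesis using zero_le_power2[of "exp (- v) / 2"] by argo
  qed
  ultimately show ?thesis by blast
qed

text \<open>Here the hypothesis of \<open>admissible_generic\<close> holds already at
  \<open>v = 0\<close>, since \<open>(n - 1) ln n \<ge> 4\<close> leaves \<open>4 n\<close> to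
  absorb the lower-order terms.\<close>

lemma admissible_ge_4:
  assumes n: "4 \<le> n" and v: "0 \<le> v"
  shows "\<exists>d t a. admissible n (real n ^ 2 * ln (real n) + 8 * real n * v) d t a \<and> 1 - exp (- v) \<le> (1 - d) ^ n * a"
proof (rule admissible_generic[OF _ v])
  have ln4: "ln (4::real) = 2 * ln 2" using ln_realpow[of 2 2] by simp
  have "4/3 \<le> ln (real n)"
    using ln_mono[of 4 "real n"] n ln2_ge_two_thirds ln4 by simp
  then have "3 * (4/3) \<le> (real n - 1) * ln (real n)" using n by (intro mult_mono) auto
  then have 1: "real n * 4 \<le> real n * ((real n - 1) * ln (real n))" by (intro mult_left_mono) auto
  have "real n * ln (2 * real n) = real n * ln 2 + real n * ln (real n)"
    using n by (subst ln_mult) (auto simp: distrib_left)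
  moreover have "real n * ln 2 \<le> real n * (25/36)" "real n * ln 3 \<le> real n * (10/9)"
    using ln2_le_25_over_36 ln_3_bounds(2) by (intro mult_left_mono; simp)+
  \<comment> \<open>Collects the logarithm bounds: \<open>85/36 = 25/36 + 3/2 * 10/9\<close> and
    \<open>377/120 = 3/2 * 25/36 + 21/10\<close>.\<close>
  moreover have "x + 3/2 * (c + y) + 21/10 \<le> z * (85/36) + w + 377/120"
    if "x = x' + w" "x' \<le> z * (25/36)" "y \<le> z * (10/9)" "c \<le> 25/36" for x x' y z w c :: real
    using that by argo
  ultimately have "real n * ln (2 * real n) + 3/2 * (ln 2 + real n * ln 3) + 21/10 \<le>
      real n * (85/36) + real n * ln (real n) + 377/120"
    using ln2_le_25_over_36 by blast
  also have "\<dots> \<le> real n * 4 + real n * ln (real n)" using n by simp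
  also have "\<dots> \<le> real n * ((real n - 1) * ln (real n)) + real n * ln (real n)" using 1 by simp
  also have "\<dots> = real n ^ 2 * ln (real n)" by (simp add: power2_eq_square algebra_simps)
  also have "\<dots> \<le> real n ^ 2 * ln (real n) + (7 * real n - 3/2) * v" using n v by simp
  finally show "real n * ln (2 * real n) + 3/2 * (ln 2 + real n * ln 3) + 21/10
      \<le> real n ^ 2 * ln (real n) + (7 * real n - 3/2) * v" .
qed (use n in auto)

text \<open>For \<open>v \<le> 1/5\<close> constant parameters suffice: the mass
  \<open>(3/5) ^ 3 * 93/100\<close> exceeds \<open>1/5 \<ge> 1 - exp (- v)\<close>, and the depth
  condition holds already at \<open>v = 0\<close>.\<close>

lemma admissible_3:
  assumes v: "0 \<le> v"
  shows "\<exists>d t a. admissible 3 (real 3 ^ 2 * ln (real 3) + 8 * real 3 * v) d t a \<and> 1 - exp (- v) \<le> (1 - d) ^ 3 * a"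
proof (cases "v \<le> 1/5")
  case False
  have "ln (2 * 3::real) = ln 2 + ln 3" by (rule ln_mult_pos) auto
  then have "3 * ln (2 * 3) + 3/2 * (ln 2 + 3 * ln 3) + 21/10 \<le> 3 ^ 2 * ln 3 + (7 * 3 - 3/2) * v"
    using False ln2_le_25_over_36 ln_3_bounds(1) by (simp only: not_le power2_eq_square) argo
  then show ?thesis by (intro admissible_generic v) auto
next
  case True
  have "admissible 3 (real 3 ^ 2 * ln (real 3) + 8 * real 3 * v) (2/5) 9 (93/100)"
    unfolding admissible_def
  proof (intro conjI)
    have "(145/128) ^ 48 \<le> exp (6::real)" using exp_ge_rational_power[of 6] by simp
    then have "386 < exp (6::real)" by (rule less_le_trans[rotated]) (simp add: power_divide)
    then have "27 * exp (- 6 :: real) < 7/100" by (simp add: exp_minus divide_simps)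
    then show "93 / 100 < 1 - 3 ^ 3 * exp (- (2 * 9 / 3 :: real))" by simp
    have "ln (5/4::real) \<le> 5/4 - 1" by (rule ln_le_minus_one) simp
    moreover have "ln (2/5::real) = - (ln 2 + ln (5/4))"
      using ln_mult[of 2 "5/4::real"] ln_div[of 2 "5::real"] ln_div[of 5 "2::real"] by simp
    ultimately have "- ln (2/5::real) \<le> 17/18" using ln2_le_25_over_36 by linarith
    then show "- real 3 * ln (2 / 5) + (1 - 2 / 5) * 9 + 1 / (93 / 100) \<le> real 3 ^ 2 * ln (real 3) + 8 * real 3 * v"
      using ln_3_bounds(1) v by simp
  qed auto
  moreover have "1 - exp (- v) \<le> (1 - 2/5) ^ 3 * (93/100)"
    using one_minus_exp_le[of v] True by (simp add: power_divide)
  ultimately show ?thesis by blast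
qed

text \<open>For small \<open>v\<close> the choice \<open>1 - d = y\<close> with
  \<open>y\<^sup>2 = 6/5 * v\<close> and \<open>a = 5/6\<close> gives mass exactly
  \<open>v \<ge> 1 - exp (- v)\<close>. Strict positivity of \<open>v\<close> ensures
  \<open>d < 1\<close>. Beyond \<open>52/100\<close> the generic choice works.\<close>

lemma admissible_2:
  assumes v: "0 < v"
  shows "\<exists>d t a. admissible 2 (real 2 ^ 2 * ln (real 2) + 8 * real 2 * v) d t a \<and> 1 - exp (- v) \<le> (1 - d) ^ 2 * a"
proof (cases "v \<le> 52/100")
  case False
  have "ln (2 * 2::real) = ln 2 + ln 2" by (rule ln_mult_pos) auto
  then have "2 * ln (2 * 2) + 3/2 * (ln 2 + 2 * ln 3) + 21/10 \<le> 2 ^ 2 * ln 2 + (7 * 2 - 3/2) * v"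
    using False ln2_le_25_over_36 ln_3_bounds(2) by (simp only: not_le power2_eq_square) argo
  then show ?thesis using v by (intro admissible_generic) auto
next
  case True
  define y where "y = sqrt (6/5 * v)"
  have y2: "y\<^sup>2 = 6/5 * v" "0 < y" using v by (auto simp: y_def)
  have y: "y \<le> 79/100" by (rule power2_le_imp_le) (use y2 True in \<open>auto simp: power_divide\<close>)
  have "admissible 2 (real 2 ^ 2 * ln (real 2) + 8 * real 2 * v) (1 - y) 6 (5/6)"
    unfolding admissible_def
  proof (intro conjI)
    have "(145/128) ^ 32 \<le> exp (4::real)" using exp_ge_rational_power[of 4] by simp
    then have "54 < exp (4::real)" by (rule less_le_trans[rotated]) (simp add: power_divide)
    then have "9 * exp (- 4 :: real) < 1/6" by (simp add: exp_minus divide_simps)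
    then show "5 / 6 < 1 - 3 ^ 2 * exp (- (2 * 6 / 3 :: real))" by simp
    have nonpos: "e \<le> 0"
      if "q \<le> 1/5" "p \<le> 0" "e = 40/3 * p + 1/15 * q - (4/375 + 7/75) * y - (19067/150000 - 7/75)" "0 < y"
      for e p q :: real
      using that by argo
    have "\<bar>y - 37/100\<bar> \<le> 42/100" using y y2(2) by (intro abs_leI; argo)
    then have "\<bar>y - 37/100\<bar>\<^sup>2 \<le> (42/100)\<^sup>2" by (rule power_mono) simp
    then have "(y - 37/100)\<^sup>2 \<le> 1/5" by (simp add: power_divide)
    moreover have "(y - 37/100)\<^sup>2 * (y - 79/100) \<le> 0" using y by (intro mult_nonneg_nonpos) auto
    \<comment> \<open>Clearing denominators in the depth condition leaves a cubic in
      \<open>y\<close>. It is expanded around \<open>37/100\<close>, near its local maximum, and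
      \<open>79/100\<close>, the upper bound on \<open>y\<close>, so the leading term is nonpositive
      and the rest is small.\<close>
    moreover have "y * (2 - y) + (6 * y + 6/5 - 8/3 - 40/3 * y\<^sup>2) * (1 - y) =
        40/3 * ((y - 37/100)\<^sup>2 * (y - 79/100)) + 1/15 * (y - 37/100)\<^sup>2
        - (4/375 + 7/75) * y - (19067/150000 - 7/75)"
      by (simp add: power2_eq_square field_simps)
    ultimately have "y * (2 - y) + (6 * y + 6/5 - 8/3 - 40/3 * y\<^sup>2) * (1 - y) \<le> 0"
      using y2(2) by (rule nonpos)
    then have "y * (2 - y) / (1 - y) + 6 * y + 6/5 \<le> 8/3 + 40/3 * y\<^sup>2"
      using y by (simp add: divide_simps) (simp add: algebra_simps)
    moreover have "- 2 * ln (1 - y) \<le> y * (2 - y) / (1 - y)"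
      using y y2 by (intro minus_ln_one_minus_le) auto
    moreover have "40/3 * y\<^sup>2 = 16 * v" using y2 by simp
    ultimately show "- real 2 * ln (1 - y) + (1 - (1 - y)) * 6 + 1 / (5 / 6) \<le> real 2 ^ 2 * ln (real 2) + 8 * real 2 * v"
      using ln2_ge_two_thirds by simp
  qed (use y y2 in auto)
  moreover have "1 - exp (- v) \<le> (1 - (1 - y)) ^ 2 * (5/6)"
    using one_minus_exp_le[of v] y2 by simp
  ultimately show ?thesis by blast
qed

section \<open>The tail bound for the floating body and the supremum\<close>

lemma (in log_concave_measure) floating_body_complement_le:
  assumes n: "2 \<le> DIM('a)" and s: "real DIM('a) ^ 2 * ln (real DIM('a)) < s"
  shows "1 - measure M (floating_body M s)
    \<le> exp (- ((s - real DIM('a) ^ 2 * ln (real DIM('a))) / (8 * real DIM('a))))"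
proof -
  let ?n = "DIM('a)"
  define v where "v = (s - real ?n ^ 2 * ln (real ?n)) / (8 * real ?n)"
  have v: "0 < v" using s by (simp add: v_def)
  have sv: "s = real ?n ^ 2 * ln (real ?n) + 8 * real ?n * v" by (simp add: v_def)
  have "\<exists>d t a. admissible ?n s d t a \<and> 1 - exp (- v) \<le> (1 - d) ^ ?n * a"
  proof -
    consider "?n = 2" | "?n = 3" | "4 \<le> ?n" using n by linarith
    then show ?thesis
    proof cases
      case 1
      show ?thesis unfolding sv 1 by (rule admissible_2[OF v])
    next
      case 2
      show ?thesis unfolding sv 2 by (rule admissible_3[OF less_imp_le[OF v]])
    next
      case 3
      show ?thesis unfolding sv by (rule admissible_ge_4[OF 3 less_imp_le[OF v]])
    qed
  qed
  then obtain d t a where adm: "admissible ?n s d t a" and mass: "1 - exp (- v) \<le> (1 - d) ^ ?n * a"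
    by blast
  have d: "0 < d" "d < 1" and t: "0 \<le> t" and a: "0 < a" "a < 1 - 3 ^ ?n * exp (- (2 * t / 3))"
    and depth: "- real ?n * ln d + (1 - d) * t + 1 / a \<le> s"
    using adm unfolding admissible_def by blast+
  have "- s \<le> real ?n * ln d + - ((1 - d) * t) + - (1 / a)"
    using depth by argo
  then have "exp (- s) \<le> exp (real ?n * ln d + - ((1 - d) * t) + - (1 / a))"
    by (simp only: exp_le_cancel_iff)
  also have "\<dots> = d ^ ?n * exp (- ((1 - d) * t)) * exp (- (1 / a))"
    using d(1) by (simp only: exp_add exp_of_nat_mult exp_ln)
  finally have "(1 - d) ^ ?n * a \<le> measure M (floating_body M s)"
    by (rule measure_floating_body_ge[OF a t d])
  then show ?thesis using mass unfolding v_def by linarith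
qed

theorem theorem1p5:
  fixes M :: "(real ^ 'n) measure"
  assumes "CARD('n) \<ge> 2"
    and "log_concave_prob M"
  shows "(SUP s\<in>{0<..}. ereal (exp ((1 / 8) * (s / real CARD('n))) *
            (1 - measure M (floating_body M s))))
         \<le> ereal (exp (real CARD('n) * ln (real CARD('n)) / 8))"
proof (rule SUP_least)
  fix s :: real
  let ?n = "real CARD('n)"
  interpret log_concave_measure M
    using assms(2) by (auto simp: log_concave_prob_def log_concave_measure_def log_concave_measure_axioms_def)
  have dim: "DIM(real ^ 'n) = CARD('n)" by simp
  have n: "0 < ?n" by simp
  have "exp (1 / 8 * (s / ?n)) * (1 - measure M (floating_body M s)) \<le> exp (?n * ln ?n / 8)"
  \<comment> \<open>Up to this threshold the exponential factor alone is at most the constant;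
    beyond it the tail bound applies.\<close>
  proof (cases "s \<le> ?n ^ 2 * ln ?n")
    case True
    then have "1 / 8 * (s / ?n) \<le> ?n * ln ?n / 8"
      using n by (simp add: divide_simps power2_eq_square mult_ac)
    then have "exp (1 / 8 * (s / ?n)) * (1 - measure M (floating_body M s)) \<le> exp (?n * ln ?n / 8) * 1"
      by (intro mult_mono) auto
    then show ?thesis by simp
  next
    case False
    then have "1 - measure M (floating_body M s) \<le> exp (- ((s - ?n ^ 2 * ln ?n) / (8 * ?n)))"
      using floating_body_complement_le[of s, unfolded dim] assms(1) by simp
    then have "exp (1 / 8 * (s / ?n)) * (1 - measure M (floating_body M s)) \<le>
        exp (1 / 8 * (s / ?n)) * exp (- ((s - ?n ^ 2 * ln ?n) / (8 * ?n)))"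
      by (intro mult_left_mono) auto
    also have "\<dots> = exp (1 / 8 * (s / ?n) + - ((s - ?n ^ 2 * ln ?n) / (8 * ?n)))"
      by (rule exp_add[symmetric])
    \<comment> \<open>Growth and decay have the same rate \<open>1 / (8 n)\<close> in
      \<open>s\<close>, so only the offset \<open>n\<^sup>2 ln n / (8 n)\<close> survives.\<close>
    also have "1 / 8 * (s / ?n) + - ((s - ?n ^ 2 * ln ?n) / (8 * ?n)) = ?n * ln ?n / 8"
      using n by (simp add: divide_simps power2_eq_square)
    finally show ?thesis .
  qed
  then show "ereal (exp (1 / 8 * (s / ?n)) * (1 - measure M (floating_body M s))) \<le> ereal (exp (?n * ln ?n / 8))"
    by simp
qed

end
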